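(* Let $(K,\sigma,D)$ be a model of $DCFA$ and let $\mathrm{Fix}\,\sigma=\{x\in K:\sigma(x)=x\}$ be its fixed field. Then $((\mathrm{Fix}\,\sigma)^{alg},D)$ is a model of $DCF$, i.e. a differentially closed field.
   Context: All fields have characteristic $0$. A difference-differential field is a field $K$ with a derivation $D$ and a field automorphism $\sigma$ commuting with $D$; the language is $\mathcal L_{\sigma,D}=\{0,1,+,-,\cdot,\sigma,D\}$. $DCFA$ is the model companion of the theory of difference-differential fields of characteristic $0$ (its models are the existentially closed difference-differential fields). $DCF$ is the theory of differentially closed fields of characteristic $0$ (with one derivation). $F^{alg}$ denotes the field-theoretic algebraic closure of $F$ (taken inside $K$, which is algebraically closed), with the restriction of $D$. *)

theory Defs
  imports "HOL-Algebra.Finite_Extensions" "HOL-Algebra.Indexed_Polynomials"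
begin

section \<open>Differential and difference-differential fields of characteristic 0\<close>

text \<open>The operators are total functions on the ambient type; only their values on the carrier
  matter.\<close>

locale differential_field = field R for R (structure) +
  fixes D :: "'a \<Rightarrow> 'a"
  assumes char_zero: "\<And>n::nat. n > 0 \<Longrightarrow> add_pow R n \<one> \<noteq> \<zero>"
    and deriv_closed: "\<And>x. x \<in> carrier R \<Longrightarrow> D x \<in> carrier R"
    and deriv_add: "\<And>x y. x \<in> carrier R \<Longrightarrow> y \<in> carrier R \<Longrightarrow> D (x \<oplus> y) = D x \<oplus> D y"
    and deriv_mult: "\<And>x y. x \<in> carrier R \<Longrightarrow> y \<in> carrier R \<Longrightarrow>
      D (x \<otimes> y) = (D x \<otimes> y) \<oplus> (x \<otimes> D y)"

locale difference_differential_field = differential_field +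
  fixes s :: "'a \<Rightarrow> 'a"
  assumes automorphism: "s \<in> ring_iso R R"
    and commute: "\<And>x. x \<in> carrier R \<Longrightarrow> s (D x) = D (s x)"

section \<open>Quantifier-free formulas with parameters and models of DCFA\<close>

datatype 'a sd_term =
    Param 'a
  | Var nat
  | Zero
  | One
  | Plus "'a sd_term" "'a sd_term"
  | Minus "'a sd_term" "'a sd_term"
  | Times "'a sd_term" "'a sd_term"
  | Sigma "'a sd_term"
  | Deriv "'a sd_term"

datatype 'a sd_formula =
    Equal "'a sd_term" "'a sd_term"
  | Neg "'a sd_formula"
  | Conj "'a sd_formula" "'a sd_formula"

text \<open>Parameters from a structure on the type \<open>'a\<close> are interpreted in a structure on \<open>'b\<close> through
  a map \<open>h\<close>; the valuation \<open>v\<close> interprets the variables.\<close>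

primrec eval_term :: "('b, 'm) ring_scheme \<Rightarrow> ('b \<Rightarrow> 'b) \<Rightarrow> ('b \<Rightarrow> 'b) \<Rightarrow> ('a \<Rightarrow> 'b) \<Rightarrow>
    (nat \<Rightarrow> 'b) \<Rightarrow> 'a sd_term \<Rightarrow> 'b" where
  "eval_term R D s h v (Param c) = h c"
| "eval_term R D s h v (Var i) = v i"
| "eval_term R D s h v Zero = \<zero>\<^bsub>R\<^esub>"
| "eval_term R D s h v One = \<one>\<^bsub>R\<^esub>"
| "eval_term R D s h v (Plus t u) = eval_term R D s h v t \<oplus>\<^bsub>R\<^esub> eval_term R D s h v u"
| "eval_term R D s h v (Minus t u) = eval_term R D s h v t \<ominus>\<^bsub>R\<^esub> eval_term R D s h v u"
| "eval_term R D s h v (Times t u) = eval_term R D s h v t \<otimes>\<^bsub>R\<^esub> eval_term R D s h v u"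
| "eval_term R D s h v (Sigma t) = s (eval_term R D s h v t)"
| "eval_term R D s h v (Deriv t) = D (eval_term R D s h v t)"

primrec holds :: "('b, 'm) ring_scheme \<Rightarrow> ('b \<Rightarrow> 'b) \<Rightarrow> ('b \<Rightarrow> 'b) \<Rightarrow> ('a \<Rightarrow> 'b) \<Rightarrow>
    (nat \<Rightarrow> 'b) \<Rightarrow> 'a sd_formula \<Rightarrow> bool" where
  "holds R D s h v (Equal t u) \<longleftrightarrow> eval_term R D s h v t = eval_term R D s h v u"
| "holds R D s h v (Neg p) \<longleftrightarrow> \<not> holds R D s h v p"
| "holds R D s h v (Conj p q) \<longleftrightarrow> holds R D s h v p \<and> holds R D s h v q"

text \<open>The models of DCFA are the existentially closed difference-differential fields.  An extension
  of \<open>R\<close> is an embedding \<open>h\<close> of \<open>R\<close> into a difference-differential field \<open>L\<close>; a ring homomorphism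
  of fields is injective.  HOL cannot quantify over the type carrying \<open>L\<close>, but type \<open>'a\<close> is large
  enough: if a quantifier-free formula over \<open>R\<close> is satisfied in some extension, then it is satisfied
  in the difference-differential subfield generated by the image of \<open>R\<close> and the finitely many
  witnesses, and this subfield has the same cardinality as the infinite set \<open>carrier R\<close>.  So up to
  isomorphism no extension is lost; since \<open>h\<close> need not be an inclusion, this also covers the case
  \<open>carrier R = UNIV\<close>.\<close>

definition DCFA_model :: "('a, 'm) ring_scheme \<Rightarrow> ('a \<Rightarrow> 'a) \<Rightarrow> ('a \<Rightarrow> 'a) \<Rightarrow> bool" where
  "DCFA_model R D s \<longleftrightarrow>
     difference_differential_field R D s \<and>
     (\<forall>(p :: 'a sd_formula) (L :: 'a ring) D' s' h v.
        set_sd_formula p \<subseteq> carrier R \<longrightarrow>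
        difference_differential_field L D' s' \<longrightarrow>
        h \<in> ring_hom R L \<longrightarrow>
        (\<forall>x \<in> carrier R. h (D x) = D' (h x) \<and> h (s x) = s' (h x)) \<longrightarrow>
        (\<forall>i. v i \<in> carrier L) \<longrightarrow>
        holds L D' s' h v p \<longrightarrow>
        (\<exists>w. (\<forall>i. w i \<in> carrier R) \<and> holds R D s id w p))"

section \<open>Differential polynomials and models of DCF\<close>

text \<open>A differential polynomial in one differential indeterminate \<open>x\<close> is an ordinary polynomial in
  the variables indexed by \<open>i :: nat\<close>, where the variable with index \<open>i\<close> stands for the \<open>i\<close>-th
  derivative of \<open>x\<close>.  Elements of the field have order \<open>-1\<close>.\<close>

context differential_field
begin

definition diff_polys :: "(nat multiset \<Rightarrow> 'a) set" where
  "diff_polys = indexed_pset UNIV (carrier R)"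

definition diff_order :: "(nat multiset \<Rightarrow> 'a) \<Rightarrow> int" where
  "diff_order P =
     (if \<forall>i. index_free P i then -1 else int (Max {i. \<not> index_free P i}))"

definition diff_eval :: "(nat multiset \<Rightarrow> 'a) \<Rightarrow> 'a \<Rightarrow> 'a" where
  "diff_eval P a =
     (\<Oplus>m \<in> {m. P m \<noteq> \<zero>}. P m \<otimes> (\<Otimes>i \<in> set_mset m. (D ^^ i) a [^] count m i))"

end

text \<open>Blum's axioms.  The case where \<open>f\<close> has order \<open>0\<close> and \<open>g\<close> is a nonzero constant says that the
  field is algebraically closed.\<close>

definition DCF_model :: "('a, 'm) ring_scheme \<Rightarrow> ('a \<Rightarrow> 'a) \<Rightarrow> bool" where
  "DCF_model R D \<longleftrightarrow>
     differential_field R D \<and>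
     (\<forall>f \<in> differential_field.diff_polys R. \<forall>g \<in> differential_field.diff_polys R.
        g \<noteq> (\<lambda>_. \<zero>\<^bsub>R\<^esub>) \<longrightarrow>
        differential_field.diff_order R g < differential_field.diff_order R f \<longrightarrow>
        (\<exists>a \<in> carrier R. differential_field.diff_eval R D f a = \<zero>\<^bsub>R\<^esub> \<and>
                         differential_field.diff_eval R D g a \<noteq> \<zero>\<^bsub>R\<^esub>))"

section \<open>Fixed field and relative algebraic closure\<close>

definition Fix :: "('a, 'm) ring_scheme \<Rightarrow> ('a \<Rightarrow> 'a) \<Rightarrow> 'a set" where
  "Fix K s = {x \<in> carrier K. s x = x}"

definition algebraic_closure_in :: "('a, 'm) ring_scheme \<Rightarrow> 'a set \<Rightarrow> ('a, 'm) ring_scheme" where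
  "algebraic_closure_in K F = K\<lparr>carrier := {x \<in> carrier K. (ring.algebraic K over F) x}\<rparr>"

end

theory Submission
  imports Defs "HOL-Algebra.Algebraic_Closure_Type" "HOL-Library.Poly_Mapping"
begin

text \<open>An element \<open>x\<close> of \<open>K\<close> is algebraic over \<open>Fix \<sigma>\<close> iff \<open>\<sigma>\<^sup>n x = x\<close> for some \<open>n > 0\<close>.  So
  for \<open>f\<close> of order \<open>N\<close> and \<open>g \<noteq> 0\<close> of smaller order, with coefficients fixed by a power of \<open>\<sigma>\<close>, it
  suffices, \<open>K\<close> being existentially closed, to find in some extension of \<open>K\<close> a \<open>\<sigma>\<close>-periodic
  solution of \<open>f = 0 \<noteq> g\<close>.

  Extend \<open>\<sigma>\<close> to an automorphism \<open>\<tau>\<close> of the algebraic closure \<open>M\<close> of \<open>K\<close>, and embed \<open>K\<close> into the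
  Laurent series over \<open>M\<close> by \<open>x \<mapsto> \<Sum> D\<^sup>n x / n! X\<^sup>n\<close>; the series carry the derivation \<open>d/dX\<close> and
  \<open>\<tau>\<close> acting on coefficients, which commute for trivial reasons.  There \<open>f = 0\<close> is an ordinary
  differential equation.  After replacing \<open>f\<close> by a factor that is separable in the \<open>N\<close>-th
  derivative, choose integers as initial values of the derivatives of order \<open>< N\<close>, avoiding the
  zeros of \<open>g\<close> and of finitely many other polynomials, and a simple root \<open>\<zeta> \<in> M\<close> as the initial
  value of the \<open>N\<close>-th one.  As \<open>\<zeta>\<close> is a root of a polynomial whose coefficients are fixed by a power
  of \<open>\<tau>\<close>, it is \<open>\<tau>\<close>-periodic.  The power series solution with these initial values is unique,
  hence it is periodic as well.\<close>

hide_const (open) Polynomials.degree Polynomials.lead_coeff Poly_Mapping.degree up_ring.monom up_ring.coeff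

section \<open>Ring homomorphisms between commutative rings given as types\<close>

locale ring_homo =
  fixes h :: "'a::comm_ring_1 \<Rightarrow> 'b::comm_ring_1"
  assumes one: "h 1 = 1"
    and add: "h (x + y) = h x + h y"
    and mult: "h (x * y) = h x * h y"
begin

lemma zero: "h 0 = 0"
  using add[of 0 0] by simp

lemma uminus: "h (- x) = - h x"
  using add[of x "- x"] by (intro minus_unique[symmetric]) (simp add: zero)

lemma diff: "h (x - y) = h x - h y"
  using add[of x "- y"] by (simp add: uminus)

lemma sum: "h (sum f A) = (\<Sum>x\<in>A. h (f x))"
  by (induction A rule: infinite_finite_induct) (auto simp: zero add)

lemma prod: "h (prod f A) = (\<Prod>x\<in>A. h (f x))"
  by (induction A rule: infinite_finite_induct) (auto simp: one mult)

lemma power: "h (x ^ n) = h x ^ n"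
  by (induction n) (auto simp: one mult)

lemma prod_mset: "h (prod_mset (image_mset f M)) = prod_mset (image_mset (\<lambda>i. h (f i)) M)"
  by (induction M) (auto simp: one mult)

lemma of_nat: "h (of_nat n) = of_nat n"
  by (induction n) (auto simp: zero one add)

lemma poly: "h (poly p x) = poly (map_poly h p) (h x)"
  by (induction p) (auto simp: zero add mult map_poly_pCons)

lemma map_poly_homo: "ring_homo (map_poly h)"
proof
  show "map_poly h 1 = 1"
    by (simp add: map_poly_1 one)
  show "map_poly h (p + q) = map_poly h p + map_poly h q" for p q
    by (rule poly_eqI) (simp add: coeff_map_poly zero add)
  show "map_poly h (p * q) = map_poly h p * map_poly h q" for p q
    by (rule poly_eqI) (simp add: coeff_map_poly zero coeff_mult sum mult)
qed

lemma map_poly_smult: "map_poly h (smult c p) = smult (h c) (map_poly h p)"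
  by (rule poly_eqI) (simp add: coeff_map_poly zero mult)

lemma map_poly_monom: "map_poly h (monom c n) = monom (h c) n"
  by (rule poly_eqI) (simp add: coeff_map_poly zero)

end

lemma map_poly_pderiv:
  fixes h :: "'a::idom \<Rightarrow> 'b::idom"
  assumes "ring_homo h"
  shows "map_poly h (pderiv p) = pderiv (map_poly h p)"
proof -
  interpret ring_homo h by fact
  show ?thesis
    by (rule poly_eqI) (simp add: coeff_map_poly zero one add coeff_pderiv mult of_nat)
qed

lemma ring_homo_funpow:
  fixes h :: "'a::comm_ring_1 \<Rightarrow> 'a"
  shows "ring_homo h \<Longrightarrow> ring_homo (h ^^ n)"
  by (induction n) (auto simp: ring_homo_def)

section \<open>Extending an automorphism to the algebraic closure\<close>

text \<open>A partial extension is given by its graph and not by a map, so polynomials are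
  transported along a relation between their coefficients.\<close>

definition poly_rel :: "('a \<times> 'b) set \<Rightarrow> 'a::zero poly \<Rightarrow> 'b::zero poly \<Rightarrow> bool" where
  "poly_rel G p q \<longleftrightarrow> (\<forall>i. (coeff p i, coeff q i) \<in> G)"

text \<open>With graphs, unions of chains and passage to the inverse are immediate. The domain is
  treated as a subring, so the extension step avoids divisions. Closure under differences reduces
  single-valuedness to pairs with first component \<open>0\<close>.\<close>

locale partial_extension =
  fixes s :: "'k::field \<Rightarrow> 'k" and G :: "('k alg_closure \<times> 'k alg_closure) set"
  assumes homo: "ring_homo s"
    and base: "\<And>x. (to_ac x, to_ac (s x)) \<in> G"
    and add: "(x, y) \<in> G \<Longrightarrow> (x', y') \<in> G \<Longrightarrow> (x + x', y + y') \<in> G"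
    and mult: "(x, y) \<in> G \<Longrightarrow> (x', y') \<in> G \<Longrightarrow> (x * x', y * y') \<in> G"
    and uminus: "(x, y) \<in> G \<Longrightarrow> (- x, - y) \<in> G"
    and single_valued: "(0, y) \<in> G \<Longrightarrow> y = 0"
begin

lemma zero: "(0, 0) \<in> G"
  using base[of 0] by (simp add: ring_homo.zero[OF homo])

lemma one: "(1, 1) \<in> G"
  using base[of 1] by (simp add: ring_homo.one[OF homo])

lemma diff: "(x, y) \<in> G \<Longrightarrow> (x', y') \<in> G \<Longrightarrow> (x - x', y - y') \<in> G"
  using add[OF _ uminus] by fastforce

lemma sum: "(\<And>i. i \<in> A \<Longrightarrow> (f i, g i) \<in> G) \<Longrightarrow> (sum f A, sum g A) \<in> G"
  by (induction A rule: infinite_finite_induct) (auto simp: zero add)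

lemma poly_rel_poly:
  assumes "poly_rel G p q" "(x, y) \<in> G"
  shows "(poly p x, poly q y) \<in> G"
  using assms(1)
proof (induction p q rule: poly_induct2)
  case 0
  then show ?case by (simp add: zero)
next
  case (pCons a p b q)
  have rel: "(coeff (pCons a p) i, coeff (pCons b q) i) \<in> G" for i
    using pCons.prems by (simp add: poly_rel_def)
  have "(a, b) \<in> G" "poly_rel G p q"
    using rel[of 0] rel[of "Suc i" for i] by (simp_all add: poly_rel_def)
  then show ?case
    using pCons.IH assms(2) by (simp add: add mult)
qed

lemma poly_rel_base: "poly_rel G (map_poly to_ac p) (map_poly to_ac (map_poly s p))"
  by (simp add: poly_rel_def coeff_map_poly base ring_homo.zero[OF homo])

lemma poly_rel_add:
  "poly_rel G p q \<Longrightarrow> poly_rel G p' q' \<Longrightarrow> poly_rel G (p + p') (q + q')"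
  by (simp add: poly_rel_def add)

lemma poly_rel_diff:
  "poly_rel G p q \<Longrightarrow> poly_rel G p' q' \<Longrightarrow> poly_rel G (p - p') (q - q')"
  by (simp add: poly_rel_def diff)

lemma poly_rel_mult:
  "poly_rel G p q \<Longrightarrow> poly_rel G p' q' \<Longrightarrow> poly_rel G (p * p') (q * q')"
  by (simp add: poly_rel_def coeff_mult sum mult)

lemma poly_rel_smult: "(x, y) \<in> G \<Longrightarrow> poly_rel G p q \<Longrightarrow> poly_rel G (smult x p) (smult y q)"
  by (simp add: poly_rel_def mult)

lemma poly_rel_zero: "poly_rel G 0 0"
  by (simp add: poly_rel_def zero)

lemma poly_rel_monom: "(x, y) \<in> G \<Longrightarrow> poly_rel G (monom x n) (monom y n)"
  by (simp add: poly_rel_def zero)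

lemma poly_rel_pCons: "(x, y) \<in> G \<Longrightarrow> poly_rel G p q \<Longrightarrow> poly_rel G (pCons x p) (pCons y q)"
  by (auto simp: poly_rel_def coeff_pCons split: nat.split)

lemma poly_rel_0: "poly_rel G 0 q \<Longrightarrow> q = 0"
  by (rule poly_eqI) (auto simp: poly_rel_def intro: single_valued)

text \<open>A minimal polynomial of \<open>x \<noteq> 0\<close> over the base field has a nonzero constant term, which is
  its value at \<open>0\<close>.\<close>

lemma injective:
  assumes "(x, 0) \<in> G"
  shows "x = 0"
proof (rule ccontr)
  assume x: "x \<noteq> 0"
  define Q where "Q p \<longleftrightarrow> p \<noteq> 0 \<and> poly (map_poly to_ac p) x = 0" for p
  obtain p0 where "Q p0"
    using alg_closure_algebraic[of x] by (auto simp: Q_def)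
  then obtain p where p: "Q p" and min: "\<And>q. Q q \<Longrightarrow> degree p \<le> degree q"
    using ex_has_least_nat[of Q p0 degree] by blast
  obtain c r where pc: "p = pCons c r"
    by (cases p)
  have "c \<noteq> 0"
  proof
    assume "c = 0"
    then have "Q r"
      using p x by (auto simp: Q_def pc map_poly_pCons)
    with min[of r] \<open>c = 0\<close> show False
      using p by (auto simp: pc Q_def split: if_splits)
  qed
  \<comment> \<open>Transport along the pair \<open>(x, 0)\<close> relates the value
    \<open>0\<close> to the constant term \<open>s c\<close>, which therefore vanishes although
    \<open>c\<close> is invertible.\<close>
  have "(poly (map_poly to_ac p) x, poly (map_poly to_ac (map_poly s p)) 0) \<in> G"
    by (rule poly_rel_poly[OF poly_rel_base assms])
  then have "to_ac (s c) = 0"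
    using p by (intro single_valued) (simp add: Q_def pc map_poly_pCons ring_homo.zero[OF homo])
  then have "s (c * inverse c) = 0"
    by (simp add: ring_homo.mult[OF homo])
  then show False
    using \<open>c \<noteq> 0\<close> by (simp add: ring_homo.one[OF homo])
qed

text \<open>Adjunction of one element: \<open>b\<close> goes to a root \<open>b'\<close> of the
  transport \<open>q'\<close> of a polynomial \<open>q\<close> of least degree annihilating
  \<open>b\<close>. The point to check is that \<open>poly P' b'\<close> depends only on
  \<open>poly P b\<close>.\<close>

lemma extend:
  obtains G' where "partial_extension s G'" "G \<subseteq> G'" "b \<in> Domain G'"
proof -
  define Q where "Q q \<longleftrightarrow> q \<noteq> 0 \<and> poly q b = 0 \<and> (\<exists>q'. poly_rel G q q')" for q
  obtain q0 where "Q q0"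
  proof -
    obtain p where p: "p \<noteq> 0" "poly (map_poly to_ac p) b = 0"
      using alg_closure_algebraic[of b] by auto
    then have "map_poly to_ac p \<noteq> 0"
      by (simp add: map_poly_eq_0_iff)
    then show thesis
      using p poly_rel_base that unfolding Q_def by blast
  qed
  then obtain q where q: "Q q" and min: "\<And>r. Q r \<Longrightarrow> degree q \<le> degree r"
    using ex_has_least_nat[of Q q0 degree] by blast
  obtain q' where q': "poly_rel G q q'"
    using q by (auto simp: Q_def)
  \<comment> \<open>\<open>G\<close> is injective and single-valued at \<open>0\<close>, so
    \<open>q\<close> and \<open>q'\<close> have zero coefficients at the same indices. Hence
    \<open>q'\<close> has positive degree, and a root.\<close>
  have coeff0: "coeff q i = 0 \<longleftrightarrow> coeff q' i = 0" for i
    using q' single_valued injective unfolding poly_rel_def by metis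
  then have deg: "degree q' = degree q"
    by (simp add: Polynomial.degree_def)
  have dq: "degree q > 0"
    using q by (auto simp: Q_def intro!: Nat.gr0I elim!: degree_eq_zeroE)
  obtain b' where b': "poly q' b' = 0"
    using alg_closed_imp_poly_has_root[of q'] deg dq by auto
  \<comment> \<open>This is single-valuedness at \<open>0\<close>. The induction pseudo-divides by
    \<open>q\<close>: scaling \<open>P\<close> by the leading coefficient of \<open>q\<close>
    replaces division.\<close>
  have well: "poly P' b' = 0" if "poly_rel G P P'" "poly P b = 0" for P P'
    using that
  proof (induction "degree P" arbitrary: P P' rule: less_induct)
    case less
    show ?case
    proof (cases "degree P < degree q")
      case True
      then have "P = 0"
        using min[of P] less.prems unfolding Q_def by force
      then show ?thesis
        using less.prems(1) poly_rel_0[of P'] by simp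
    next
      case False
      define n where "n = degree P - degree q"
      define P1 where "P1 = smult (lead_coeff q) P - monom (lead_coeff P) n * q"
      \<comment> \<open>The coefficient of \<open>P'\<close> is taken at index
        \<open>degree P\<close>, because that is the partner of \<open>lead_coeff P\<close> under
        \<open>G\<close>.\<close>
      define P1' where "P1' = smult (lead_coeff q') P' - monom (coeff P' (degree P)) n * q'"
      have "degree P1 \<le> degree P"
        unfolding P1_def using False
        by (intro degree_diff_le order.trans[OF degree_mult_le])
           (auto simp: n_def intro: order.trans[OF add_mono[OF degree_monom_le order.refl]])
      moreover have "coeff P1 (degree P) = 0"
        unfolding P1_def using False by (simp add: coeff_monom_mult n_def)
      ultimately have "degree P1 < degree P \<or> P1 = 0"
        by (metis eq_zero_or_degree_less)
      then have lt: "degree P1 < degree P"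
        using False dq by auto
      have rel: "poly_rel G P1 P1'"
        unfolding P1_def P1'_def
        using less.prems(1) q' unfolding deg
        by (intro poly_rel_diff poly_rel_smult poly_rel_mult poly_rel_monom)
           (auto simp: poly_rel_def)
      have "poly P1 b = 0"
        using less.prems q by (simp add: P1_def Q_def)
      then have "poly P1' b' = 0"
        using less.hyps[OF lt rel] by blast
      then have "lead_coeff q' * poly P' b' = 0"
        by (simp add: P1'_def b')
      moreover have "lead_coeff q' \<noteq> 0"
        using coeff0[of "degree q"] q by (auto simp: deg Q_def)
      ultimately show ?thesis by simp
    qed
  qed
  define G' where "G' = {(poly P b, poly P' b') |P P'. poly_rel G P P'}"
  have G'I: "(poly P b, poly P' b') \<in> G'" if "poly_rel G P P'" for P P'
    using that by (auto simp: G'_def)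
  have const: "(x, y) \<in> G'" if "(x, y) \<in> G" for x y
    using G'I[OF poly_rel_pCons[OF that poly_rel_zero]] by simp
  have "partial_extension s G'"
  proof (rule partial_extension.intro)
    show "ring_homo s" by (rule homo)
    show "(to_ac x, to_ac (s x)) \<in> G'" for x
      by (intro const base)
  next
    fix x y x' y' assume xy: "(x, y) \<in> G'"
    then obtain P P' where P: "x = poly P b" "y = poly P' b'" "poly_rel G P P'"
      by (auto simp: G'_def)
    show "(- x, - y) \<in> G'"
      using G'I[OF poly_rel_diff[OF poly_rel_zero P(3)]] by (simp add: P)
    assume "(x', y') \<in> G'"
    then obtain R R' where R: "x' = poly R b" "y' = poly R' b'" "poly_rel G R R'"
      by (auto simp: G'_def)
    show "(x + x', y + y') \<in> G'"
      using G'I[OF poly_rel_add[OF P(3) R(3)]] by (simp add: P R)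
    show "(x * x', y * y') \<in> G'"
      using G'I[OF poly_rel_mult[OF P(3) R(3)]] by (simp add: P R)
  next
    show "y = 0" if "(0, y) \<in> G'" for y
      using that well by (auto simp: G'_def)
  qed
  moreover have "G \<subseteq> G'"
    using const by auto
  moreover have "(b, b') \<in> G'"
    using G'I[OF poly_rel_pCons[OF zero poly_rel_pCons[OF one poly_rel_zero]]] by simp
  ultimately show thesis
    using that by blast
qed

end

text \<open>The converse of a maximal partial extension is again one, of the inverse automorphism; so
  only totality has to be shown.\<close>

lemma partial_extension_converse:
  fixes s :: "'k::field \<Rightarrow> 'k"
  assumes "partial_extension s G" "bij s"
  shows "partial_extension (inv_into UNIV s) (G\<inverse>)"
proof -
  interpret partial_extension s G by fact
  have [simp]: "s (inv_into UNIV s x) = x" for x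
    using assms(2) by (simp add: bij_is_surj surj_f_inv_f)
  have [simp]: "inv_into UNIV s (s x) = x" for x
    using assms(2) by (simp add: bij_is_inj)
  show ?thesis
  proof (rule partial_extension.intro)
    show "ring_homo (inv_into UNIV s)"
    proof
      show "inv_into UNIV s 1 = 1"
        by (metis \<open>\<And>x. inv_into UNIV s (s x) = x\<close> ring_homo.one[OF homo])
      show "inv_into UNIV s (x + y) = inv_into UNIV s x + inv_into UNIV s y" for x y
        by (rule injD[OF bij_is_inj[OF assms(2)]]) (simp add: ring_homo.add[OF homo])
      show "inv_into UNIV s (x * y) = inv_into UNIV s x * inv_into UNIV s y" for x y
        by (rule injD[OF bij_is_inj[OF assms(2)]]) (simp add: ring_homo.mult[OF homo])
    qed
    show "(to_ac x, to_ac (inv_into UNIV s x)) \<in> G\<inverse>" for x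
      using base[of "inv_into UNIV s x"] by simp
  qed (auto intro: add mult uminus injective)
qed

text \<open>Zorn's lemma, starting from the graph of \<open>s\<close> on the base field. Each
  closure rule involves at most two pairs, and in a chain these lie in a common member.\<close>

lemma maximal_partial_extension:
  fixes s :: "'k::field \<Rightarrow> 'k"
  assumes s: "ring_homo s"
  obtains G where "partial_extension s G"
    "\<And>G'. partial_extension s G' \<Longrightarrow> G \<subseteq> G' \<Longrightarrow> G' = G"
proof -
  interpret ring_homo s by fact
  define S where "S = {G. partial_extension s G}"
  have "\<exists>M\<in>S. \<forall>G\<in>S. M \<subseteq> G \<longrightarrow> G = M"
  proof (rule subset_Zorn_nonempty)
    have "{(to_ac x, to_ac (s x)) |x. True} \<in> S"
      unfolding S_def mem_Collect_eq
    proof (rule partial_extension.intro)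
      show "(x, y) \<in> {(to_ac x, to_ac (s x)) |x. True} \<Longrightarrow>
          (x', y') \<in> {(to_ac x, to_ac (s x)) |x. True} \<Longrightarrow>
          (x + x', y + y') \<in> {(to_ac x, to_ac (s x)) |x. True}" for x y x' y'
        by clarify (metis to_ac_add add)
      show "(x, y) \<in> {(to_ac x, to_ac (s x)) |x. True} \<Longrightarrow>
          (x', y') \<in> {(to_ac x, to_ac (s x)) |x. True} \<Longrightarrow>
          (x * x', y * y') \<in> {(to_ac x, to_ac (s x)) |x. True}" for x y x' y'
        by clarify (metis to_ac_mult mult)
      show "(x, y) \<in> {(to_ac x, to_ac (s x)) |x. True} \<Longrightarrow>
          (- x, - y) \<in> {(to_ac x, to_ac (s x)) |x. True}" for x y
        by clarify (metis to_ac_minus uminus)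
    qed (auto simp: s zero)
    then show "S \<noteq> {}" by blast
    fix C assume C: "C \<noteq> {}" "subset.chain S C"
    then have ext: "partial_extension s G" if "G \<in> C" for G
      using that by (auto simp: S_def subset.chain_def)
    have common: "\<exists>G\<in>C. u \<in> G \<and> v \<in> G" if "u \<in> \<Union>C" "v \<in> \<Union>C" for u v
    proof -
      obtain A B where "A \<in> C" "u \<in> A" "B \<in> C" "v \<in> B"
        using \<open>u \<in> \<Union>C\<close> \<open>v \<in> \<Union>C\<close> by blast
      moreover have "A \<subseteq> B \<or> B \<subseteq> A"
        using C(2) \<open>A \<in> C\<close> \<open>B \<in> C\<close> by (auto simp: subset_chain_def)
      ultimately show ?thesis by blast
    qed
    show "\<Union>C \<in> S"
      unfolding S_def mem_Collect_eq
    proof (rule partial_extension.intro)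
      show "ring_homo s" by fact
      show "(to_ac x, to_ac (s x)) \<in> \<Union>C" for x
        using C ext partial_extension.base by blast
      show "(x, y) \<in> \<Union>C \<Longrightarrow> (x', y') \<in> \<Union>C \<Longrightarrow> (x + x', y + y') \<in> \<Union>C" for x y x' y'
        using common[of "(x, y)" "(x', y')"] ext partial_extension.add by blast
      show "(x, y) \<in> \<Union>C \<Longrightarrow> (x', y') \<in> \<Union>C \<Longrightarrow> (x * x', y * y') \<in> \<Union>C" for x y x' y'
        using common[of "(x, y)" "(x', y')"] ext partial_extension.mult by blast
      show "(x, y) \<in> \<Union>C \<Longrightarrow> (- x, - y) \<in> \<Union>C" for x y
        using ext partial_extension.uminus by blast
      show "(0, y) \<in> \<Union>C \<Longrightarrow> y = 0" for y
        using ext partial_extension.single_valued by blast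
    qed
  qed
  then show thesis
    using that by (auto simp: S_def)
qed

text \<open>A maximal graph has full domain by \<open>extend\<close>; the same lemma for its
  converse gives full range.\<close>

theorem alg_closure_automorphism:
  fixes s :: "'k::field \<Rightarrow> 'k"
  assumes s: "ring_homo s" "bij s"
  obtains t :: "'k alg_closure \<Rightarrow> 'k alg_closure"
    where "ring_homo t" "bij t" "\<And>x. t (to_ac x) = to_ac (s x)"
proof -
  obtain G where G: "partial_extension s G"
    and max: "\<And>G'. partial_extension s G' \<Longrightarrow> G \<subseteq> G' \<Longrightarrow> G' = G"
    using maximal_partial_extension[OF s(1)] by blast
  interpret partial_extension s G by fact
  have dom: "b \<in> Domain G" for b
  proof -
    obtain G' where "partial_extension s G'" "G \<subseteq> G'" "b \<in> Domain G'"
      by (rule extend)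
    then show ?thesis
      using max[of G'] by simp
  qed
  interpret conv: partial_extension "inv_into UNIV s" "G\<inverse>"
    by (rule partial_extension_converse[OF G s(2)])
  have "b \<in> Domain (G\<inverse>)" for b
  proof -
    obtain G' where G': "partial_extension (inv_into UNIV s) G'" "G\<inverse> \<subseteq> G'" "b \<in> Domain G'"
      by (rule conv.extend)
    \<comment> \<open>Turned around again, an extension of the converse extends \<open>G\<close>, so
      maximality of \<open>G\<close> applies to it.\<close>
    have "partial_extension s (G'\<inverse>)"
      using partial_extension_converse[OF G'(1)] s(2) by (simp add: bij_imp_bij_inv inv_inv_eq)
    then have "G'\<inverse> = G"
      using max[of "G'\<inverse>"] G'(2) converse_mono[of G "G'\<inverse>"] by simp
    then show ?thesis
      using G'(3) by blast
  qed
  then have ran: "\<exists>x. (x, b) \<in> G" for b by blast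
  have uniq: "y = y'" if "(x, y) \<in> G" "(x, y') \<in> G" for x y y'
    using diff[OF that] single_valued[of "y - y'"] by simp
  have uniq': "x = x'" if "(x, y) \<in> G" "(x', y) \<in> G" for x x' y
    using diff[OF that] injective[of "x - x'"] by simp
  define t where "t x = (THE y. (x, y) \<in> G)" for x
  have t: "(x, y) \<in> G \<longleftrightarrow> t x = y" for x y
  proof -
    obtain z where z: "(x, z) \<in> G"
      using dom[of x] by blast
    then have "t x = z"
      unfolding t_def using uniq by blast
    then show ?thesis
      using z uniq by blast
  qed
  have "ring_homo t"
  proof
    have graph: "(x, t x) \<in> G" for x
      by (simp add: t)
    show "t 1 = 1"
      using one t by blast
    show "t (x + y) = t x + t y" for x y
      using add[OF graph graph] t by blast
    show "t (x * y) = t x * t y" for x y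
      using mult[OF graph graph] t by blast
  qed
  moreover have "bij t"
    unfolding bij_def inj_def surj_def using ran uniq' t by metis
  moreover have "t (to_ac x) = to_ac (s x)" for x
    using base by (simp add: t)
  ultimately show thesis
    using that by blast
qed

section \<open>Separable factors\<close>

text \<open>Over an integral domain, division with remainder works after scaling by some
  \<open>c \<noteq> 0\<close>. Each step multiplies only by coefficients fixed by
  \<open>\<phi>\<close>, so the remainder stays invariant.\<close>

lemma pseudo_division:
  fixes \<phi> :: "'r::idom \<Rightarrow> 'r"
  assumes \<phi>: "ring_homo \<phi>" and r: "map_poly \<phi> r = r" "r \<noteq> 0" and p: "map_poly \<phi> p = p"
  obtains c q s where "c \<noteq> 0" "smult c p = r * q + s" "s = 0 \<or> degree s < degree r" "map_poly \<phi> s = s"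
proof -
  interpret ring_homo \<phi> by fact
  interpret map: ring_homo "map_poly \<phi>" by (rule map_poly_homo)
  have fixed_coeff: "\<phi> (coeff u i) = coeff u i" if "map_poly \<phi> u = u" for u i
    using that by (metis coeff_map_poly zero)
  have "\<exists>c q s. c \<noteq> 0 \<and> smult c p = r * q + s \<and> (s = 0 \<or> degree s < degree r) \<and> map_poly \<phi> s = s"
    using p
  proof (induction "degree p" arbitrary: p rule: less_induct)
    case less
    show ?case
    proof (cases "degree p < degree r \<or> p = 0")
      case True
      then show ?thesis
        using less.prems by (intro exI[of _ 1] exI[of _ 0] exI[of _ p]) auto
    next
      case False
      define m where "m = monom (lead_coeff p) (degree p - degree r)"
      define p1 where "p1 = smult (lead_coeff r) p - m * r"
      have fixed: "map_poly \<phi> p1 = p1"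
        unfolding p1_def m_def
        by (simp add: map.diff map.mult map_poly_smult map_poly_monom less.prems r(1) fixed_coeff)
      have "degree p1 \<le> degree p"
        unfolding p1_def m_def using False
        by (intro degree_diff_le order.trans[OF degree_mult_le])
           (auto intro: order.trans[OF add_mono[OF degree_monom_le order.refl]])
      moreover have "coeff p1 (degree p) = 0"
        unfolding p1_def m_def using False by (simp add: coeff_monom_mult)
      ultimately have lt: "degree p1 < degree p \<or> p1 = 0"
        by (metis eq_zero_or_degree_less)
      \<comment> \<open>The case \<open>p1 = 0\<close> is treated apart: if \<open>p\<close> is
        constant, the degree has not dropped.\<close>
      have "\<exists>c q s. c \<noteq> 0 \<and> smult c p1 = r * q + s \<and> (s = 0 \<or> degree s < degree r) \<and> map_poly \<phi> s = s"
      proof (cases "p1 = 0")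
        case True
        then show ?thesis
          by (intro exI[of _ 1] exI[of _ 0]) (auto simp: map.zero)
      next
        case False
        then show ?thesis
          using less.hyps[of p1] lt fixed by blast
      qed
      then obtain c q s where cqs: "c \<noteq> 0" "smult c p1 = r * q + s"
          "s = 0 \<or> degree s < degree r" "map_poly \<phi> s = s"
        by blast
      have "smult (c * lead_coeff r) p = smult c p1 + smult c (m * r)"
        by (simp add: p1_def smult_diff_right)
      also have "\<dots> = r * (q + smult c m) + s"
        by (simp add: cqs(2) algebra_simps)
      finally show ?thesis
        using cqs r(2) by (intro exI[of _ "c * lead_coeff r"] exI) auto
    qed
  qed
  then show thesis
    using that by blast
qed

text \<open>A \<open>\<phi>\<close>-invariant substitute for a separable factor of \<open>f\<close> over the fraction field of \<open>'r\<close>: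
  a factor \<open>p\<close> of minimal degree (up to denominators) is coprime to its derivative, since
  otherwise the common divisor would be a smaller one.\<close>

lemma invariant_separable_factor:
  fixes \<phi> :: "'r::{idom,ring_char_0} \<Rightarrow> 'r"
  assumes \<phi>: "ring_homo \<phi>" and f: "map_poly \<phi> f = f" "degree f > 0"
  obtains p d q u v e where "map_poly \<phi> p = p" "degree p > 0" "d \<noteq> 0" "smult d f = p * q"
    "e \<noteq> 0" "u * p + v * pderiv p = [:e:]"
proof -
  interpret ring_homo \<phi> by fact
  interpret map: ring_homo "map_poly \<phi>" by (rule map_poly_homo)
  define good where "good p \<longleftrightarrow> map_poly \<phi> p = p \<and> degree p > 0 \<and> (\<exists>d q. d \<noteq> 0 \<and> smult d f = p * q)" for p
  have "good f"
    using f unfolding good_def by (intro conjI exI[of _ 1]) auto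
  then obtain p where p: "good p" and p_min: "\<And>p'. good p' \<Longrightarrow> degree p \<le> degree p'"
    using ex_has_least_nat[of good f degree] by blast
  obtain d q where dq: "d \<noteq> 0" "smult d f = p * q"
    using p by (auto simp: good_def)
  \<comment> \<open>An element of least degree stands in for the gcd of \<open>p\<close> and
    \<open>pderiv p\<close>. There is one to choose because \<open>pderiv p \<noteq> 0\<close> in
    characteristic 0.\<close>
  define comb where "comb r \<longleftrightarrow> r \<noteq> 0 \<and> map_poly \<phi> r = r \<and> (\<exists>u v. r = u * p + v * pderiv p)" for r
  have p': "comb (pderiv p)"
    unfolding comb_def
  proof (intro conjI exI)
    show "pderiv p \<noteq> 0"
      using p by (simp add: good_def pderiv_eq_0_iff)
    show "map_poly \<phi> (pderiv p) = pderiv p"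
      using p by (simp add: good_def map_poly_pderiv[OF \<phi>])
    show "pderiv p = 0 * p + 1 * pderiv p"
      by simp
  qed
  then obtain r where r: "comb r" and r_min: "\<And>r'. comb r' \<Longrightarrow> degree r \<le> degree r'"
    using ex_has_least_nat[of comb "pderiv p" degree] by blast
  obtain u v where uv: "r = u * p + v * pderiv p"
    using r by (auto simp: comb_def)
  have "degree r < degree p"
    using r_min[OF p'] p by (auto simp: good_def degree_pderiv)
  \<comment> \<open>Otherwise pseudo-division of \<open>p\<close> by \<open>r\<close> leaves an
    invariant combination of smaller degree, hence \<open>0\<close>. Then \<open>r\<close> divides
    \<open>f\<close> up to a constant factor, against the choice of \<open>p\<close>.\<close>
  have "degree r = 0"
  proof (rule ccontr)
    assume "degree r \<noteq> 0"
    obtain c q' s where s: "c \<noteq> 0" "smult c p = r * q' + s" "s = 0 \<or> degree s < degree r" "map_poly \<phi> s = s"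
      using pseudo_division[OF \<phi>, of r p] r p by (auto simp: good_def comb_def)
    have "s = ([:c:] - q' * u) * p + (- q' * v) * pderiv p"
      using s(2) by (simp add: uv algebra_simps)
    then have "s = 0"
      using r_min[of s] s(3,4) unfolding comb_def by (metis not_less)
    have "smult (d * c) f = r * (q' * q)"
      using dq(2) s(2) \<open>s = 0\<close> by (metis add.right_neutral mult.assoc mult_smult_left smult_smult mult.commute)
    then have "good r"
      using r \<open>degree r \<noteq> 0\<close> dq(1) s(1) unfolding good_def comb_def
      by (intro conjI exI[of _ "d * c"] exI[of _ "q' * q"]) auto
    then show False
      using p_min[of r] \<open>degree r < degree p\<close> by simp
  qed
  then obtain e where "r = [:e:]"
    by (rule degree_eq_zeroE)
  then show thesis
    using that[of p d q e u v] p dq r uv by (auto simp: good_def comb_def)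
qed

section \<open>Polynomials in many variables\<close>

text \<open>These polynomials form an integral domain when \<open>'k\<close> does, so the results on
  separable factors apply to \<open>'k mpoly poly\<close>.\<close>

type_synonym 'k mpoly = "(nat \<Rightarrow>\<^sub>0 nat) \<Rightarrow>\<^sub>0 'k"

lemma poly_mapping_sum_single:
  "r = (\<Sum>m\<in>Poly_Mapping.keys r. Poly_Mapping.single m (Poly_Mapping.lookup r m))"
  by (rule poly_mapping_eqI)
    (auto simp: lookup_sum lookup_single when_def in_keys_iff)

definition monom_eval :: "(nat \<Rightarrow> 'b::comm_ring_1) \<Rightarrow> (nat \<Rightarrow>\<^sub>0 nat) \<Rightarrow> 'b" where
  "monom_eval y m = (\<Prod>i\<in>Poly_Mapping.keys m. y i ^ Poly_Mapping.lookup m i)"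

definition mpoly_eval ::
    "('k::zero \<Rightarrow> 'b::comm_ring_1) \<Rightarrow> (nat \<Rightarrow> 'b) \<Rightarrow> 'k mpoly \<Rightarrow> 'b" where
  "mpoly_eval h y r = (\<Sum>m\<in>Poly_Mapping.keys r. h (Poly_Mapping.lookup r m) * monom_eval y m)"

lemma monom_eval_superset:
  assumes "finite A" "Poly_Mapping.keys m \<subseteq> A"
  shows "monom_eval y m = (\<Prod>i\<in>A. y i ^ Poly_Mapping.lookup m i)"
  unfolding monom_eval_def using assms
  by (intro prod.mono_neutral_left) (auto simp: in_keys_iff)

lemma monom_eval_0: "monom_eval y 0 = 1"
  by (simp add: monom_eval_def)

lemma monom_eval_add: "monom_eval y (m + n) = monom_eval y m * monom_eval y n"
proof -
  let ?A = "Poly_Mapping.keys m \<union> Poly_Mapping.keys n"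
  have "Poly_Mapping.keys (m + n) \<subseteq> ?A"
    by (rule Poly_Mapping.keys_add)
  then show ?thesis
    by (simp add: monom_eval_superset[where A = ?A] lookup_add power_add prod.distrib)
qed

lemma monom_eval_single: "monom_eval y (Poly_Mapping.single i n) = y i ^ n"
  by (simp add: monom_eval_def)

lemma monom_eval_homo:
  "ring_homo T \<Longrightarrow> T (monom_eval y m) = monom_eval (\<lambda>i. T (y i)) m"
  by (simp add: monom_eval_def ring_homo.prod ring_homo.power)

lemma monom_eval_times: "monom_eval (\<lambda>i. y i * z i) m = monom_eval y m * monom_eval z m"
  by (simp add: monom_eval_def power_mult_distrib prod.distrib)

lemma mpoly_eval_homo:
  assumes "ring_homo h"
  shows "ring_homo (mpoly_eval h y)"
proof -
  interpret ring_homo h by fact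
  have superset: "mpoly_eval h y r = (\<Sum>m\<in>A. h (Poly_Mapping.lookup r m) * monom_eval y m)"
    if "finite A" "Poly_Mapping.keys r \<subseteq> A" for A r
    unfolding mpoly_eval_def using that
    by (intro sum.mono_neutral_left) (auto simp: in_keys_iff zero)
  have single: "mpoly_eval h y (Poly_Mapping.single m c) = h c * monom_eval y m" for m c
    by (simp add: superset[of "{m}"])
  have plus: "mpoly_eval h y (r + r') = mpoly_eval h y r + mpoly_eval h y r'" for r r'
  proof -
    let ?A = "Poly_Mapping.keys r \<union> Poly_Mapping.keys r'"
    have "Poly_Mapping.keys (r + r') \<subseteq> ?A"
      by (rule Poly_Mapping.keys_add)
    then show ?thesis
      by (simp add: superset[of ?A] lookup_add add algebra_simps sum.distrib)
  qed
  have sum: "mpoly_eval h y (sum f A) = (\<Sum>x\<in>A. mpoly_eval h y (f x))" for f and A :: "'c set"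
    by (induction A rule: infinite_finite_induct) (auto simp: plus, auto simp: mpoly_eval_def)
  have times: "mpoly_eval h y (r * r') = mpoly_eval h y r * mpoly_eval h y r'" for r r'
  proof -
    have "mpoly_eval h y (r * r') =
        mpoly_eval h y ((\<Sum>m\<in>Poly_Mapping.keys r. Poly_Mapping.single m (Poly_Mapping.lookup r m)) *
          (\<Sum>m\<in>Poly_Mapping.keys r'. Poly_Mapping.single m (Poly_Mapping.lookup r' m)))"
      by (simp flip: poly_mapping_sum_single)
    also have "\<dots> = mpoly_eval h y r * mpoly_eval h y r'"
      unfolding sum_product sum mult_single single mult monom_eval_add
      unfolding mpoly_eval_def sum_product by (intro sum.cong) (simp_all add: algebra_simps)
    finally show ?thesis .
  qed
  show ?thesis
  proof
    show "mpoly_eval h y 1 = 1"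
      using single[of 0 1] by (simp add: one monom_eval_0)
  qed (fact plus times)+
qed

lemma mpoly_eval_single:
  assumes "ring_homo h"
  shows "mpoly_eval h y (Poly_Mapping.single m c) = h c * monom_eval y m"
  using ring_homo.zero[OF assms] by (simp add: mpoly_eval_def)

lemma homo_mpoly_eval:
  "ring_homo T \<Longrightarrow> T (mpoly_eval h y r) = mpoly_eval (\<lambda>x. T (h x)) (\<lambda>i. T (y i)) r"
  by (simp add: mpoly_eval_def ring_homo.sum ring_homo.mult monom_eval_homo)

lemma dvd_power_diff: "d dvd a - b \<Longrightarrow> d dvd a ^ n - b ^ n" for d :: "'b::comm_ring_1"
  by (metis dvd_trans dvd_triv_left power_diff_sumr2)

lemma dvd_mult_diff:
  fixes d :: "'b::comm_ring_1"
  assumes "d dvd a - b" "d dvd a' - b'"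
  shows "d dvd a * a' - b * b'"
proof -
  have "a * a' - b * b' = (a - b) * a' + b * (a' - b')"
    by (simp add: algebra_simps)
  then show ?thesis
    using assms by simp
qed

text \<open>Used with powers of \<open>fps_X\<close> as \<open>d\<close>: series that agree up to
  some order give values that agree up to the same order.\<close>

lemma dvd_mpoly_eval_diff:
  assumes "\<And>i. d dvd y i - z i"
  shows "d dvd mpoly_eval h y r - mpoly_eval h z r"
proof -
  have "d dvd (\<Prod>i\<in>A. y i ^ e i) - (\<Prod>i\<in>A. z i ^ e i)" for e and A :: "nat set"
    by (induction A rule: infinite_finite_induct) (auto intro!: dvd_mult_diff dvd_power_diff assms)
  then have "d dvd monom_eval y m - monom_eval z m" for m
    by (simp add: monom_eval_def)
  then show ?thesis
    by (simp add: mpoly_eval_def flip: sum_subtractf right_diff_distrib) (intro dvd_sum dvd_mult)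
qed

text \<open>Written as an evaluation at the variables themselves, so that
  \<open>mpoly_eval_homo\<close> makes it a ring homomorphism.\<close>

definition coeff_map :: "('k::comm_ring_1 \<Rightarrow> 'k) \<Rightarrow> 'k mpoly \<Rightarrow> 'k mpoly" where
  "coeff_map s = mpoly_eval (\<lambda>c. Poly_Mapping.single 0 (s c))
     (\<lambda>i. Poly_Mapping.single (Poly_Mapping.single i 1) 1)"

lemma monom_eval_var:
  "monom_eval (\<lambda>i. Poly_Mapping.single (Poly_Mapping.single i 1) (1::'k::comm_ring_1)) m =
    Poly_Mapping.single m 1"
proof -
  have "Poly_Mapping.single (Poly_Mapping.single i 1) (1::'k) ^ n =
      Poly_Mapping.single (Poly_Mapping.single i n) 1" for i n :: nat
    by (induction n) (auto simp: mult_single simp flip: single_add)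
  moreover have "(\<Prod>i\<in>A. Poly_Mapping.single (f i) (1::'k)) = Poly_Mapping.single (\<Sum>i\<in>A. f i) 1"
    for f :: "nat \<Rightarrow> nat \<Rightarrow>\<^sub>0 nat" and A
    by (induction A rule: infinite_finite_induct) (auto simp: mult_single)
  ultimately show ?thesis
    by (simp add: monom_eval_def flip: poly_mapping_sum_single)
qed

lemma lookup_coeff_map:
  assumes "s 0 = 0"
  shows "Poly_Mapping.lookup (coeff_map s r) m = s (Poly_Mapping.lookup r m)"
  unfolding coeff_map_def mpoly_eval_def monom_eval_var using assms
  by (auto simp: mult_single lookup_sum lookup_single when_def in_keys_iff)

lemma coeff_map_homo:
  assumes "ring_homo s"
  shows "ring_homo (coeff_map s)"
proof -
  have "ring_homo (\<lambda>c. Poly_Mapping.single (0::nat \<Rightarrow>\<^sub>0 nat) (s c))"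
    using assms by (auto simp: ring_homo_def single_add mult_single)
  then show ?thesis
    unfolding coeff_map_def by (rule mpoly_eval_homo)
qed

text \<open>Artin's argument: the relation at \<open>f z x\<close> minus \<open>\<chi> n z\<close>
  times the relation at \<open>x\<close> no longer involves \<open>\<chi> n\<close>. By induction
  its coefficients \<open>a m * (\<chi> m z - \<chi> n z)\<close> vanish for all \<open>z\<close>,
  and some \<open>z\<close> separates \<open>m\<close> from \<open>n\<close>.\<close>

lemma dedekind_independent_characters:
  fixes \<chi> :: "'m \<Rightarrow> 'g \<Rightarrow> 'k::idom"
  assumes "finite A"
    and "\<And>m x y. m \<in> A \<Longrightarrow> \<chi> m (f x y) = \<chi> m x * \<chi> m y"
    and "\<And>m. m \<in> A \<Longrightarrow> \<exists>x. \<chi> m x \<noteq> 0"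
    and "\<And>m n. m \<in> A \<Longrightarrow> n \<in> A \<Longrightarrow> m \<noteq> n \<Longrightarrow> \<exists>x. \<chi> m x \<noteq> \<chi> n x"
    and "\<And>x. (\<Sum>m\<in>A. a m * \<chi> m x) = 0"
  shows "\<forall>m\<in>A. a m = 0"
  using assms
proof (induction A arbitrary: a rule: finite_induct)
  case empty
  then show ?case by simp
next
  case (insert n A)
  have eq: "a n * \<chi> n x + (\<Sum>m\<in>A. a m * \<chi> m x) = 0" for x
    using insert.prems(4)[of x] insert.hyps by simp
  have "\<forall>m\<in>A. a m * (\<chi> m z - \<chi> n z) = 0" for z
  proof (rule insert.IH)
    fix x
    have "(\<Sum>m\<in>A. a m * (\<chi> m z - \<chi> n z) * \<chi> m x) =
        (\<Sum>m\<in>A. a m * \<chi> m (f z x)) - \<chi> n z * (\<Sum>m\<in>A. a m * \<chi> m x)"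
      using insert.prems(1) by (simp add: sum_distrib_left algebra_simps flip: sum_subtractf)
    also have "\<dots> = (a n * \<chi> n (f z x) + (\<Sum>m\<in>A. a m * \<chi> m (f z x)))
        - \<chi> n z * (a n * \<chi> n x + (\<Sum>m\<in>A. a m * \<chi> m x))"
      using insert.prems(1) by (simp add: algebra_simps)
    also have "\<dots> = 0"
      unfolding eq by simp
    finally show "(\<Sum>m\<in>A. a m * (\<chi> m z - \<chi> n z) * \<chi> m x) = 0" .
  qed (use insert.prems in auto)
  then have A: "a m = 0" if "m \<in> A" for m
    using insert.prems(3)[of m n] insert.hyps that by auto
  then have "a n * \<chi> n x = 0" for x
    using eq[of x] by simp
  then show ?case
    using A insert.prems(2)[of n] by auto
qed

text \<open>Monomials are distinct characters of the functions \<open>nat \<Rightarrow> nat\<close>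
  under pointwise multiplication, hence linearly independent. Natural numbers are wanted as values
  because every ring homomorphism fixes them.\<close>

lemma mpoly_nonvanishing:
  fixes r :: "'k::{idom,ring_char_0} mpoly"
  assumes "r \<noteq> 0"
  obtains c :: "nat \<Rightarrow> nat" where "mpoly_eval (\<lambda>x. x) (\<lambda>i. of_nat (c i)) r \<noteq> 0"
proof (rule ccontr)
  assume "\<not> thesis"
  then have vanish: "mpoly_eval (\<lambda>x. x) (\<lambda>i. of_nat (c i)) r = 0" for c :: "nat \<Rightarrow> nat"
    using that by blast
  define \<chi> :: "(nat \<Rightarrow>\<^sub>0 nat) \<Rightarrow> (nat \<Rightarrow> nat) \<Rightarrow> 'k" where
    "\<chi> m c = monom_eval (\<lambda>i. of_nat (c i)) m" for m c
  have "\<forall>m\<in>Poly_Mapping.keys r. Poly_Mapping.lookup r m = 0"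
  proof (rule dedekind_independent_characters[where \<chi> = \<chi> and f = "\<lambda>x y i. x i * y i"])
    show "\<chi> m (\<lambda>i. x i * y i) = \<chi> m x * \<chi> m y" for m x y
      by (simp add: \<chi>_def monom_eval_times)
    show "\<exists>x. \<chi> m x \<noteq> 0" for m
      by (rule exI[of _ "\<lambda>_. 1"]) (simp add: \<chi>_def monom_eval_def)
    show "\<exists>x. \<chi> m x \<noteq> \<chi> n x" if "m \<noteq> n" for m n
    proof -
      obtain i where i: "Poly_Mapping.lookup m i \<noteq> Poly_Mapping.lookup n i"
        using \<open>m \<noteq> n\<close> by (meson poly_mapping_eqI)
      \<comment> \<open>The value \<open>2\<close> at an index where the exponents differ and
        \<open>1\<close> elsewhere separates the monomials: distinct powers of 2 stay distinct in
        characteristic 0.\<close>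
      have "\<chi> k (\<lambda>j. if j = i then 2 else 1) = of_nat (2 ^ Poly_Mapping.lookup k i)" for k
      proof -
        have "\<chi> k (\<lambda>j. if j = i then 2 else 1) =
            (\<Prod>j\<in>Poly_Mapping.keys k. if j = i then 2 ^ Poly_Mapping.lookup k i else 1)"
          unfolding \<chi>_def monom_eval_def by (intro prod.cong) auto
        also have "\<dots> = of_nat (2 ^ Poly_Mapping.lookup k i)"
          by (simp add: prod.delta in_keys_iff)
        finally show ?thesis .
      qed
      then show ?thesis
        using i by (intro exI[of _ "\<lambda>j. if j = i then 2 else 1"]) (simp del: of_nat_power)
    qed
    show "(\<Sum>m\<in>Poly_Mapping.keys r. Poly_Mapping.lookup r m * \<chi> m c) = 0" for c
      using vanish[of c] by (simp add: mpoly_eval_def \<chi>_def)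
  qed simp
  then have "Poly_Mapping.keys r = {}"
    by (metis all_not_in_conv in_keys_iff)
  then show False
    using assms by simp
qed

section \<open>Differential polynomials turned into ordinary ones\<close>

definition mset_monom :: "nat multiset \<Rightarrow> nat \<Rightarrow>\<^sub>0 nat" where
  "mset_monom m = (\<Sum>i\<in>#m. Poly_Mapping.single i 1)"

lemma lookup_mset_monom: "Poly_Mapping.lookup (mset_monom m) i = count m i"
  by (induction m) (auto simp: mset_monom_def lookup_add lookup_single when_def)

lemma mset_monom_eq_iff: "mset_monom m = mset_monom n \<longleftrightarrow> m = n"
  by (metis lookup_mset_monom multiset_eqI)

lemma monom_eval_mset_monom: "monom_eval y (mset_monom m) = (\<Prod>i\<in>#m. y i)"
  by (induction m) (auto simp: mset_monom_def monom_eval_0 monom_eval_add monom_eval_single)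

text \<open>The map \<open>h\<close> lets one expression serve for the model itself, with
  \<open>h\<close> the identity, and for its image among the power series.\<close>

definition dpoly_eval :: "('k::zero \<Rightarrow> 'b::comm_ring_1) \<Rightarrow> (nat \<Rightarrow> 'b) \<Rightarrow> (nat multiset \<Rightarrow> 'k) \<Rightarrow> 'b" where
  "dpoly_eval h y P = (\<Sum>m\<in>{m. P m \<noteq> 0}. h (P m) * (\<Prod>i\<in>#m. y i))"

definition dpoly_mpoly :: "(nat multiset \<Rightarrow> 'k::comm_ring_1) \<Rightarrow> 'k mpoly" where
  "dpoly_mpoly P = (\<Sum>m\<in>{m. P m \<noteq> 0}. Poly_Mapping.single (mset_monom m) (P m))"

lemma mpoly_eval_dpoly_mpoly:
  assumes "ring_homo h"
  shows "mpoly_eval h y (dpoly_mpoly P) = dpoly_eval h y P"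
  by (simp add: dpoly_mpoly_def dpoly_eval_def ring_homo.sum[OF mpoly_eval_homo[OF assms]]
      mpoly_eval_single[OF assms] monom_eval_mset_monom)

lemma dpoly_mpoly_nonzero:
  assumes "finite {m. P m \<noteq> 0}" "P \<noteq> (\<lambda>_. 0)"
  shows "dpoly_mpoly P \<noteq> 0"
proof -
  obtain m where m: "P m \<noteq> 0"
    using assms(2) by auto
  have "Poly_Mapping.lookup (dpoly_mpoly P) (mset_monom m) = P m"
    using assms(1) m
    by (simp add: dpoly_mpoly_def lookup_sum lookup_single when_def mset_monom_eq_iff)
  then show ?thesis
    using m by auto
qed

text \<open>Index \<open>N\<close> becomes the outer variable because the equation is solved for the
  highest derivative, and separability is wanted in that variable.\<close>

definition dpoly_poly :: "nat \<Rightarrow> (nat multiset \<Rightarrow> 'k::comm_ring_1) \<Rightarrow> 'k mpoly poly" where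
  "dpoly_poly N P = (\<Sum>m\<in>{m. P m \<noteq> 0}.
     monom (Poly_Mapping.single (mset_monom (filter_mset (\<lambda>i. i \<noteq> N) m)) (P m)) (count m N))"

lemma filter_mset_split: "m = filter_mset (\<lambda>i. i \<noteq> N) m + replicate_mset (count m N) N"
  by (rule multiset_eqI) auto

lemma eval_dpoly_poly:
  assumes "ring_homo h"
  shows "poly (map_poly (mpoly_eval h y) (dpoly_poly N P)) z = dpoly_eval h (y(N := z)) P"
proof -
  interpret ev: ring_homo "mpoly_eval h y"
    using assms by (rule mpoly_eval_homo)
  have "(\<Prod>i\<in>#m. (y(N := z)) i) = (\<Prod>i\<in>#filter_mset (\<lambda>i. i \<noteq> N) m. y i) * z ^ count m N" for m
  proof -
    have "(\<Prod>i\<in>#m. (y(N := z)) i) =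
        (\<Prod>i\<in>#filter_mset (\<lambda>i. i \<noteq> N) m. (y(N := z)) i) * z ^ count m N"
      by (subst (1) filter_mset_split[of m N]) (simp add: prod_mset_replicate_mset)
    also have "(\<Prod>i\<in>#filter_mset (\<lambda>i. i \<noteq> N) m. (y(N := z)) i) = (\<Prod>i\<in>#filter_mset (\<lambda>i. i \<noteq> N) m. y i)"
      by (intro arg_cong[where f = prod_mset] image_mset_cong) auto
    finally show ?thesis .
  qed
  then show ?thesis
    by (simp add: dpoly_poly_def dpoly_eval_def ring_homo.sum[OF ev.map_poly_homo] poly_sum
        ev.map_poly_monom poly_monom mpoly_eval_single[OF assms] monom_eval_mset_monom mult.assoc)
qed

text \<open>No terms cancel: \<open>m\<close> is recovered from its count of \<open>N\<close> and
  the monomial of the rest.\<close>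

lemma degree_dpoly_poly:
  assumes "finite {m. P m \<noteq> 0}" "P m \<noteq> 0" "N \<in># m"
  shows "degree (dpoly_poly N P) > 0"
proof -
  define F where "F = (\<lambda>m. mset_monom (filter_mset (\<lambda>i. i \<noteq> N) m))"
  have inj: "m' = m" if "F m' = F m" "count m' N = count m N" for m'
    using that filter_mset_split[of m N] filter_mset_split[of m' N]
    by (simp add: F_def mset_monom_eq_iff)
  have "Poly_Mapping.lookup (coeff (dpoly_poly N P) (count m N)) (F m) =
      (\<Sum>m'\<in>{m. P m \<noteq> 0}. if m' = m then P m else 0)"
    unfolding dpoly_poly_def coeff_sum lookup_sum
    by (intro sum.cong) (auto simp: lookup_single when_def F_def dest: inj[unfolded F_def])
  then have "coeff (dpoly_poly N P) (count m N) \<noteq> 0"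
    using assms by auto
  then have "count m N \<le> degree (dpoly_poly N P)"
    by (rule le_degree)
  then show ?thesis
    using assms(3) by (simp add: count_greater_zero_iff[symmetric] del: count_greater_zero_iff)
qed

lemma coeff_map_dpoly_poly:
  assumes "ring_homo s" "\<And>m. s (P m) = P m"
  shows "map_poly (coeff_map s) (dpoly_poly N P) = dpoly_poly N P"
proof -
  interpret cm: ring_homo "coeff_map s"
    using assms(1) by (rule coeff_map_homo)
  have "coeff_map s (Poly_Mapping.single k (P m)) = Poly_Mapping.single k (P m)" for k m
    by (rule poly_mapping_eqI)
      (simp add: lookup_coeff_map lookup_single when_def assms ring_homo.zero[OF assms(1)])
  then show ?thesis
    by (simp add: dpoly_poly_def ring_homo.sum[OF cm.map_poly_homo] cm.map_poly_monom)
qed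

section \<open>Algebraic differential equations over power series\<close>

text \<open>\<open>U\<close> sees only the coefficients below \<open>k\<close>, so the equations are
  a well-founded recursion.\<close>

lemma fps_recursion_unique:
  fixes U :: "'a::zero fps \<Rightarrow> nat \<Rightarrow> 'a"
  shows "\<exists>!a. \<forall>k. fps_nth a k = U (fps_cutoff k a) k"
proof (rule ex_ex1I)
  define f where "f = wfrec less_than (\<lambda>g k. U (Abs_fps (\<lambda>j. if j < k then g j else 0)) k)"
  have "f k = U (Abs_fps (\<lambda>j. if j < k then f j else 0)) k" for k
    unfolding f_def by (subst wfrec) (simp_all add: cut_def cong: if_cong)
  then have "fps_nth (Abs_fps f) k = U (fps_cutoff k (Abs_fps f)) k" for k
    unfolding fps_cutoff_def fps_nth_Abs_fps .
  then show "\<exists>a. \<forall>k. fps_nth a k = U (fps_cutoff k a) k"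
    by blast
next
  fix a b
  assume a: "\<forall>k. fps_nth a k = U (fps_cutoff k a) k" and b: "\<forall>k. fps_nth b k = U (fps_cutoff k b) k"
  have "fps_nth a k = fps_nth b k" for k
  proof (induction k rule: less_induct)
    case (less k)
    then have "fps_cutoff k a = fps_cutoff k b"
      by (simp add: fps_cutoff_eq_fps_cutoff_iff)
    then show ?case
      using a b by metis
  qed
  then show "a = b"
    by (rule fps_ext)
qed

lemma fps_X_power_dvd_iff:
  fixes f :: "'a::comm_ring_1 fps"
  shows "fps_X ^ n dvd f \<longleftrightarrow> (\<forall>k<n. fps_nth f k = 0)"
proof
  assume "\<forall>k<n. fps_nth f k = 0"
  then have "f = fps_X ^ n * fps_shift n f"
    by (intro fps_ext) (simp add: fps_X_power_mult_nth)
  then show "fps_X ^ n dvd f"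
    by (rule dvdI)
qed (auto simp: fps_X_power_mult_nth dvd_def)

lemma dvd_poly_map_diff:
  fixes d :: "'b::comm_ring_1"
  assumes "E 0 = 0" "E' 0 = 0" "\<And>r. d dvd E r - E' r"
  shows "d dvd poly (map_poly E p) z - poly (map_poly E' p) z"
proof (induction p)
  case (pCons a p)
  have "poly (map_poly E (pCons a p)) z - poly (map_poly E' (pCons a p)) z =
      (E a - E' a) + z * (poly (map_poly E p) z - poly (map_poly E' p) z)"
    using assms(1,2) by (simp add: map_poly_pCons algebra_simps)
  then show ?case
    using assms(3) pCons.IH by simp
qed simp

text \<open>Taylor's formula to first order, with the remainder controlled by divisibility, as
  comparison of coefficients requires.\<close>

lemma poly_second_order:
  fixes p :: "'b::idom poly"
  shows "(z - w)\<^sup>2 dvd poly p z - poly p w - (z - w) * poly (pderiv p) w"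
proof (induction p)
  case (pCons a p)
  have "poly (pCons a p) z - poly (pCons a p) w - (z - w) * poly (pderiv (pCons a p)) w =
      z * (poly p z - poly p w - (z - w) * poly (pderiv p) w) + (z - w)\<^sup>2 * poly (pderiv p) w"
    by (simp add: pderiv_pCons algebra_simps power2_eq_square)
  then show ?case
    using pCons.IH by simp
qed simp

lemma fps_nth_funpow_deriv:
  fixes a :: "'a::field_char_0 fps"
  shows "fps_nth ((fps_deriv ^^ i) a) n = fact (n + i) / fact n * fps_nth a (n + i)"
proof (induction i arbitrary: n)
  case (Suc i)
  have "fps_nth ((fps_deriv ^^ Suc i) a) n =
      of_nat (Suc n) * (fact (Suc n + i) / fact (Suc n) * fps_nth a (Suc n + i))"
    by (simp only: funpow.simps o_apply fps_deriv_nth Suc_eq_plus1[symmetric] Suc.IH)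
  also have "\<dots> = fact (n + Suc i) / fact n * fps_nth a (n + Suc i)"
    unfolding fact_Suc[of n] by (simp del: of_nat_Suc fact_Suc)
  finally show ?case .
qed simp

lemma ring_homo_fps_nth_0: "ring_homo (\<lambda>f. fps_nth f 0)"
  by (simp add: ring_homo_def)

text \<open>The equation to be solved is \<open>p = 0\<close>, with the variable of index \<open>i < N\<close> of the coefficients of
  \<open>p\<close> standing for the \<open>i\<close>-th derivative of the unknown and the polynomial variable for the
  \<open>N\<close>-th one; the remaining variables of the coefficients are set to constants.  Equating the
  \<open>n\<close>-th coefficients gives an equation for the coefficient of index \<open>n + N\<close> of the unknown,
  which is linear, with the value of \<open>pderiv p\<close> at the initial data as leading coefficient.\<close>

locale fps_ode =
  fixes H :: "'k::idom \<Rightarrow> 'a::field_char_0 fps"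
    and p :: "'k mpoly poly" and N :: nat and c :: "nat \<Rightarrow> 'a" and \<zeta> :: 'a
  assumes H: "ring_homo H"
begin

definition arg :: "'a fps \<Rightarrow> nat \<Rightarrow> 'a fps" where
  "arg a i = (if i < N then (fps_deriv ^^ i) a else fps_const (c i))"

definition ev :: "'k mpoly poly \<Rightarrow> 'a fps \<Rightarrow> 'a fps" where
  "ev q a = poly (map_poly (mpoly_eval H (arg a)) q) ((fps_deriv ^^ N) a)"

definition ev0 :: "'k mpoly \<Rightarrow> 'a" where
  "ev0 = mpoly_eval (\<lambda>x. fps_nth (H x) 0) c"

text \<open>The factorials make \<open>c i\<close> and \<open>\<zeta>\<close> the constant terms of
  the derivatives of \<open>a\<close>.\<close>

definition init :: "'a fps \<Rightarrow> bool" where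
  "init a \<longleftrightarrow> (\<forall>i<N. fps_nth a i = c i / fact i) \<and> fps_nth a N = \<zeta> / fact N"

lemma homo: "ring_homo (mpoly_eval H y)"
  using H by (rule mpoly_eval_homo)

lemma nth_0_mpoly_eval: "init a \<Longrightarrow> fps_nth (mpoly_eval H (arg a) r) 0 = ev0 r"
proof -
  assume "init a"
  then have "fps_nth (arg a i) 0 = c i" for i
    by (simp add: arg_def init_def fps_nth_funpow_deriv)
  then show ?thesis
    by (simp add: homo_mpoly_eval[OF ring_homo_fps_nth_0] ev0_def)
qed

lemma nth_0_ev: "init a \<Longrightarrow> fps_nth (ev q a) 0 = poly (map_poly ev0 q) \<zeta>"
proof -
  assume init: "init a"
  have "fps_nth ((fps_deriv ^^ N) a) 0 = \<zeta>"
    using init by (simp add: init_def fps_nth_funpow_deriv)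
  then show ?thesis
    using nth_0_mpoly_eval[OF init] ring_homo.zero[OF homo] 
    by (simp add: ev_def ring_homo.poly[OF ring_homo_fps_nth_0] map_poly_map_poly o_def)
qed

text \<open>The derivatives of order below \<open>N\<close> agree modulo
  \<open>fps_X ^ Suc n\<close>, the \<open>N\<close>-th ones modulo \<open>fps_X ^ n\<close>. As
  \<open>n > 0\<close>, the square of the latter difference vanishes modulo
  \<open>fps_X ^ Suc n\<close>, and only the first-order term in it contributes.\<close>

lemma ev_diff:
  assumes init: "init a" "init b" and n: "n > 0" and agree: "\<And>k. k < n + N \<Longrightarrow> fps_nth a k = fps_nth b k"
  shows "fps_nth (ev p a) n - fps_nth (ev p b) n =
    poly (map_poly ev0 (pderiv p)) \<zeta> * (fact (n + N) / fact n) *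
      (fps_nth a (n + N) - fps_nth b (n + N))"
proof -
  let ?z = "(fps_deriv ^^ N) a" and ?w = "(fps_deriv ^^ N) b"
  let ?q = "map_poly (mpoly_eval H (arg b)) p"
  have "fps_X ^ Suc n dvd arg a i - arg b i" for i
    unfolding fps_X_power_dvd_iff
    by (auto simp: arg_def fps_nth_funpow_deriv agree)
  then have "fps_X ^ Suc n dvd ev p a - poly ?q ?z"
    unfolding ev_def
    by (intro dvd_poly_map_diff dvd_mpoly_eval_diff) (simp_all add: ring_homo.zero[OF homo])
  then have 1: "fps_nth (ev p a) n = fps_nth (poly ?q ?z) n"
    by (simp add: fps_X_power_dvd_iff del: power_Suc)
  have zw: "fps_X ^ n dvd ?z - ?w"
    unfolding fps_X_power_dvd_iff by (simp add: fps_nth_funpow_deriv agree)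
  then have "fps_X ^ (n + n) dvd (?z - ?w)\<^sup>2"
    by (simp add: power2_eq_square power_add mult_dvd_mono)
  moreover have "fps_X ^ Suc n dvd (fps_X :: 'a fps) ^ (n + n)"
    using n by (intro le_imp_power_dvd) simp
  ultimately have "fps_X ^ Suc n dvd poly ?q ?z - poly ?q ?w - (?z - ?w) * poly (pderiv ?q) ?w"
    by (meson dvd_trans poly_second_order)
  then have 2: "fps_nth (poly ?q ?z) n - fps_nth (poly ?q ?w) n =
      fps_nth ((?z - ?w) * poly (pderiv ?q) ?w) n"
    unfolding fps_X_power_dvd_iff by (simp del: fps_mult_nth)
  obtain u where u: "?z - ?w = fps_X ^ n * u"
    using zw by (rule dvdE)
  have "fps_nth (?z - ?w) n = fps_nth u 0"
    by (simp add: u fps_X_power_mult_nth)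
  then have u0: "fps_nth u 0 = fact (n + N) / fact n * (fps_nth a (n + N) - fps_nth b (n + N))"
    by (simp add: fps_nth_funpow_deriv algebra_simps)
  have "fps_nth ((?z - ?w) * poly (pderiv ?q) ?w) n = fps_nth (u * poly (pderiv ?q) ?w) 0"
    by (simp only: u mult.assoc fps_X_power_mult_nth) simp
  also have "\<dots> = fps_nth u 0 * fps_nth (ev (pderiv p) b) 0"
    by (simp add: ev_def map_poly_pderiv[OF homo])
  also have "\<dots> = poly (map_poly ev0 (pderiv p)) \<zeta> * (fact (n + N) / fact n) *
      (fps_nth a (n + N) - fps_nth b (n + N))"
    by (simp only: nth_0_ev[OF init(2)] u0 mult_ac)
  finally show ?thesis
    using 1 2 by (simp add: ev_def)
qed

text \<open>Truncation below \<open>k\<close> puts \<open>0\<close> at index \<open>k\<close>.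
  Comparing \<open>a\<close> with its truncation by \<open>ev_diff\<close> gives, for
  \<open>k > N\<close>, an affine linear equation for coefficient \<open>k\<close> of
  \<open>a\<close>, with the nonzero factor \<open>S k\<close>.\<close>

theorem unique_solution:
  assumes root: "poly (map_poly ev0 p) \<zeta> = 0" and simple: "poly (map_poly ev0 (pderiv p)) \<zeta> \<noteq> 0"
  shows "\<exists>!a. init a \<and> ev p a = 0"
proof -
  define S where "S k = poly (map_poly ev0 (pderiv p)) \<zeta> * (fact k / fact (k - N))" for k
  have S: "S k \<noteq> 0" for k
    using simple by (simp add: S_def)
  define U where "U b k = (if k < N then c k / fact k else if k = N then \<zeta> / fact N
      else - fps_nth (ev p b) (k - N) / S k)" for b k
  have "init a \<and> ev p a = 0 \<longleftrightarrow> (\<forall>k. fps_nth a k = U (fps_cutoff k a) k)" for a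
  proof (cases "init a")
    case True
    have low: "fps_nth a k = U (fps_cutoff k a) k" if "k \<le> N" for k
      using True that by (auto simp: init_def U_def)
    have high: "fps_nth a k = U (fps_cutoff k a) k \<longleftrightarrow> fps_nth (ev p a) (k - N) = 0" if "k > N" for k
    proof -
      have "init (fps_cutoff k a)"
        using True that by (auto simp: init_def)
      then have "fps_nth (ev p a) (k - N) - fps_nth (ev p (fps_cutoff k a)) (k - N) = S k * fps_nth a k"
        using ev_diff[OF True, of "fps_cutoff k a" "k - N"] that by (simp add: S_def)
      then show ?thesis
        using that S[of k] by (auto simp: U_def field_simps add_eq_0_iff2)
    qed
    \<comment> \<open>Coefficient \<open>0\<close> of the equation is not reached by the indices
      \<open>k > N\<close>; it vanishes because \<open>\<zeta>\<close> is a root at the initial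
      data.\<close>
    have "fps_nth (ev p a) 0 = 0"
      using nth_0_ev[OF True] root by simp
    then have "ev p a = 0 \<longleftrightarrow> (\<forall>k>N. fps_nth (ev p a) (k - N) = 0)"
      unfolding fps_eq_iff by (metis add_diff_cancel_right' fps_zero_nth gr0I less_add_same_cancel2)
    then show ?thesis
      using True low high by (metis not_less)
  next
    case False
    then show ?thesis
      by (auto simp: init_def U_def split: if_splits)
  qed
  then show ?thesis
    using fps_recursion_unique[of U] by simp
qed

end

section \<open>The Taylor morphism and periodic solutions\<close>

lemma ring_homo_divide:
  fixes h :: "'a::field \<Rightarrow> 'b::field"
  assumes "ring_homo h"
  shows "h (x / y) = h x / h y"
proof (cases "y = 0")
  case False
  interpret ring_homo h by fact
  have "h (x / y) * h y = h x" "h (inverse y) * h y = 1"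
    using False by (simp_all add: one flip: mult)
  then show ?thesis
    by (metis mult_zero_right nonzero_eq_divide_eq zero_neq_one)
qed (simp add: ring_homo.zero[OF assms])

lemma ring_homo_inj:
  fixes h :: "'a::field \<Rightarrow> 'b::field"
  assumes "ring_homo h"
  shows "inj h"
proof (rule injI)
  fix x y assume "h x = h y"
  interpret ring_homo h by fact
  have "h (x - y) = 0"
    using \<open>h x = h y\<close> by (simp add: diff)
  moreover have "h ((x - y) / (x - y)) = h (x - y) / h (x - y)"
    by (rule ring_homo_divide) fact
  ultimately show "x = y"
    by (cases "x = y") (simp_all add: one)
qed

lemma ring_homo_to_ac: "ring_homo to_ac"
  by (simp add: ring_homo_def)

definition fps_map :: "('a \<Rightarrow> 'b) \<Rightarrow> 'a fps \<Rightarrow> 'b fps" where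
  "fps_map t f = Abs_fps (\<lambda>n. t (fps_nth f n))"

lemma fps_nth_map [simp]: "fps_nth (fps_map t f) n = t (fps_nth f n)"
  by (simp add: fps_map_def)

lemma fps_map_funpow:
  fixes t :: "'a \<Rightarrow> 'a"
  shows "(fps_map t ^^ n) f = fps_map (t ^^ n) f"
  by (induction n) (auto simp: fps_eq_iff)

lemma ring_homo_fps_map:
  assumes "ring_homo t"
  shows "ring_homo (fps_map t)"
proof -
  interpret ring_homo t by fact
  show ?thesis
    by standard (simp_all add: fps_eq_iff one zero add mult fps_mult_nth sum)
qed

lemma fps_map_deriv: "ring_homo t \<Longrightarrow> fps_map t (fps_deriv f) = fps_deriv (fps_map t f)"
  by (simp add: fps_eq_iff ring_homo.mult ring_homo.add ring_homo.one ring_homo.of_nat)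

lemma fps_map_funpow_deriv:
  "ring_homo t \<Longrightarrow> fps_map t ((fps_deriv ^^ i) f) = (fps_deriv ^^ i) (fps_map t f)"
  by (induction i) (auto simp: fps_map_deriv)

lemma mpoly_eval_cong:
  "(\<And>m. h (Poly_Mapping.lookup r m) = h' (Poly_Mapping.lookup r m)) \<Longrightarrow>
    mpoly_eval h y r = mpoly_eval h' y r"
  by (simp add: mpoly_eval_def)

lemma dpoly_eval_cong:
  "(\<And>m i. P m \<noteq> 0 \<Longrightarrow> i \<in># m \<Longrightarrow> y i = z i) \<Longrightarrow> dpoly_eval h y P = dpoly_eval h z P"
  unfolding dpoly_eval_def by (intro sum.cong arg_cong2[of _ _ _ _ "(*)"] arg_cong[of _ _ prod_mset]
    image_mset_cong) auto

text \<open>The counterpart of \<open>difference_differential_field\<close> for structures whose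
  carrier is a whole type.\<close>

locale dd_field =
  fixes D s :: "'k::field_char_0 \<Rightarrow> 'k"
  assumes D_add: "D (x + y) = D x + D y"
    and D_mult: "D (x * y) = D x * y + x * D y"
    and s_homo: "ring_homo s"
    and s_bij: "bij s"
    and s_D: "s (D x) = D (s x)"
begin

lemma D_1: "D 1 = 0"
  using D_mult[of 1 1] by simp

text \<open>For the derivation \<open>d/dX\<close> and any coefficientwise automorphism, the Taylor morphism is an
  embedding of difference-differential fields, whether or not \<open>D\<close> extends to the
  coefficients.\<close>

definition taylor :: "'k \<Rightarrow> 'k alg_closure fps" where
  "taylor x = Abs_fps (\<lambda>n. to_ac ((D ^^ n) x) / fact n)"

lemma taylor_nth_0: "fps_nth (taylor x) 0 = to_ac x"
  by (simp add: taylor_def)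

lemma taylor_D: "taylor (D x) = fps_deriv (taylor x)"
  by (rule fps_ext) (simp add: taylor_def funpow_swap1 field_simps del: of_nat_Suc)

lemma D_funpow_add: "(D ^^ n) (x + y) = (D ^^ n) x + (D ^^ n) y"
  by (induction n) (auto simp: D_add)

lemma taylor_add: "taylor (x + y) = taylor x + taylor y"
  by (rule fps_ext) (simp add: taylor_def D_funpow_add add_divide_distrib)

text \<open>Coefficient \<open>n + 1\<close> is coefficient \<open>n\<close> of the derivative
  divided by \<open>n + 1\<close>. Induction on \<open>n\<close>, with \<open>x\<close> and
  \<open>y\<close> arbitrary, thus needs only the product rule and no higher Leibniz
  formula.\<close>

lemma taylor_homo: "ring_homo taylor"
proof
  have nth_Suc: "fps_nth f (Suc n) = fps_nth (fps_deriv f) n / of_nat (Suc n)"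
    for f :: "'k alg_closure fps" and n
    by (simp del: of_nat_Suc)
  have "fps_nth (taylor 1) n = fps_nth 1 n" for n
  proof (cases n)
    case (Suc m)
    have "taylor 0 = 0"
      using taylor_add[of 0 0] by simp
    then show ?thesis
      unfolding Suc nth_Suc by (simp flip: taylor_D add: D_1)
  qed (simp add: taylor_nth_0)
  then show "taylor 1 = 1"
    by (rule fps_ext)
  have "fps_nth (taylor (x * y)) n = fps_nth (taylor x * taylor y) n" for x y n
  proof (induction n arbitrary: x y)
    case (Suc n)
    then show ?case
      unfolding nth_Suc fps_deriv_mult taylor_D[symmetric] D_mult taylor_add
      by (simp only: fps_add_nth add.commute)
  qed (simp add: taylor_nth_0)
  then show "taylor (x * y) = taylor x * taylor y" for x y
    by (intro fps_ext)
qed (rule taylor_add)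

lemma fps_map_taylor:
  assumes "ring_homo t" "\<And>x. t (to_ac x) = to_ac (s x)"
  shows "fps_map t (taylor x) = taylor (s x)"
proof -
  have "s ((D ^^ n) x) = (D ^^ n) (s x)" for n
    by (induction n) (auto simp: s_D)
  moreover have "t (fact n) = fact n" for n
    using ring_homo.of_nat[OF assms(1), of "fact n"] by simp
  ultimately show ?thesis
    by (intro fps_ext) (simp add: taylor_def ring_homo_divide[OF assms(1)] assms(2))
qed

theorem periodic_solution:
  assumes t: "ring_homo t" "\<And>x. t (to_ac x) = to_ac (s x)"
    and P: "finite {m. P m \<noteq> 0}" "\<And>m. (s ^^ k) (P m) = P m"
      "P m0 \<noteq> 0" "N \<in># m0" "\<And>m i. P m \<noteq> 0 \<Longrightarrow> i \<in># m \<Longrightarrow> i \<le> N"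
    and G: "finite {m. G m \<noteq> 0}" "G \<noteq> (\<lambda>_. 0)" "\<And>m i. G m \<noteq> 0 \<Longrightarrow> i \<in># m \<Longrightarrow> i < N"
    and k: "k > 0"
  obtains a n where "n > 0" "(fps_map t ^^ n) a = a"
    "dpoly_eval taylor (\<lambda>i. (fps_deriv ^^ i) a) P = 0"
    "dpoly_eval taylor (\<lambda>i. (fps_deriv ^^ i) a) G \<noteq> 0"
proof -
  have sk: "ring_homo (s ^^ k)"
    using s_homo by (rule ring_homo_funpow)
  define f where "f = dpoly_poly N P"
  have f: "map_poly (coeff_map (s ^^ k)) f = f" "degree f > 0"
    unfolding f_def using coeff_map_dpoly_poly[OF sk] degree_dpoly_poly[OF P(1,3,4)] P(2) by auto
  obtain p d q u v e where p: "map_poly (coeff_map (s ^^ k)) p = p" "degree p > 0"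
    and d: "d \<noteq> 0" "smult d f = p * q" and e: "e \<noteq> 0" "u * p + v * pderiv p = [:e:]"
    by (rule invariant_separable_factor[OF coeff_map_homo[OF sk] f])
  have fixed: "(s ^^ k) (Poly_Mapping.lookup (coeff p j) m) = Poly_Mapping.lookup (coeff p j) m" for j m
  proof -
    have "coeff_map (s ^^ k) (coeff p j) = coeff p j"
      using p(1) by (metis coeff_map_poly ring_homo.zero[OF coeff_map_homo[OF sk]])
    then show ?thesis
      by (metis lookup_coeff_map ring_homo.zero[OF sk])
  qed
  \<comment> \<open>All that must survive at the initial data: \<open>d\<close> to return from
    \<open>p\<close> to \<open>f\<close>, \<open>e\<close> for a simple root, the leading
    coefficient for the existence of a root, and \<open>G\<close> for the inequation.\<close>
  have "d * e * lead_coeff p * dpoly_mpoly G \<noteq> 0"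
    using d(1) e(1) p(2) dpoly_mpoly_nonzero[OF G(1,2)] by auto
  then obtain c :: "nat \<Rightarrow> nat" where
    c: "mpoly_eval (\<lambda>x. x) (\<lambda>i. of_nat (c i)) (d * e * lead_coeff p * dpoly_mpoly G) \<noteq> 0"
    by (rule mpoly_nonvanishing)
  define y where "y i = (of_nat (c i) :: 'k alg_closure)" for i
  define e0 where "e0 = mpoly_eval to_ac y"
  interpret e0: ring_homo e0
    unfolding e0_def by (rule mpoly_eval_homo[OF ring_homo_to_ac])
  have "e0 r = to_ac (mpoly_eval (\<lambda>x. x) (\<lambda>i. of_nat (c i)) r)" for r
    by (simp add: homo_mpoly_eval[OF ring_homo_to_ac] e0_def y_def[abs_def])
  then have nz: "e0 d \<noteq> 0" "e0 e \<noteq> 0" "e0 (lead_coeff p) \<noteq> 0" "e0 (dpoly_mpoly G) \<noteq> 0"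
    using c by (simp_all add: ring_homo.mult[OF mpoly_eval_homo] ring_homo_def)
  have "degree (map_poly e0 p) > 0"
    using p(2) nz(3) by (simp add: map_poly_degree_eq)
  then obtain \<zeta> where \<zeta>: "poly (map_poly e0 p) \<zeta> = 0"
    using alg_closed_imp_poly_has_root by blast

  have tk: "ring_homo (t ^^ j)" for j
    using t(1) by (rule ring_homo_funpow)
  have t_to_ac: "(t ^^ j) (to_ac x) = to_ac ((s ^^ j) x)" for j x
    by (induction j) (auto simp: t(2))
  have t_y: "(t ^^ j) (y i) = y i" for i j
    unfolding y_def by (rule ring_homo.of_nat[OF tk])
  have "(t ^^ k) (e0 (coeff p j)) = e0 (coeff p j)" for j
    unfolding e0_def homo_mpoly_eval[OF tk] t_y t_to_ac
    by (rule mpoly_eval_cong) (simp add: fixed)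
  then have "map_poly (t ^^ k) (map_poly e0 p) = map_poly e0 p"
    by (intro poly_eqI) (simp add: coeff_map_poly e0.zero ring_homo.zero[OF tk])
  then have roots: "poly (map_poly e0 p) ((t ^^ k) z) = 0" if "poly (map_poly e0 p) z = 0" for z
    using ring_homo.poly[OF tk, of k "map_poly e0 p" z] that by (simp add: ring_homo.zero[OF tk])
  \<comment> \<open>The injective map \<open>t ^^ k\<close> sends roots to roots. The orbit of
    \<open>\<zeta>\<close> is therefore finite and returns to \<open>\<zeta>\<close>.\<close>
  have "poly (map_poly e0 p) (((t ^^ k) ^^ j) \<zeta>) = 0" for j
    by (induction j) (auto simp: \<zeta> roots)
  then have "{z. \<exists>j. z = ((t ^^ k) ^^ j) \<zeta>} \<subseteq> {z. poly (map_poly e0 p) z = 0}"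
    by auto
  moreover have "finite {z. poly (map_poly e0 p) z = 0}"
    using \<open>degree (map_poly e0 p) > 0\<close> by (intro poly_roots_finite) auto
  ultimately obtain j where j: "j > 0" "((t ^^ k) ^^ j) \<zeta> = \<zeta>"
    using funpow_inj_finite[OF ring_homo_inj[OF tk[of k]], of \<zeta>] by (metis finite_subset)
  define n where "n = k * j"
  have n: "n > 0" "(t ^^ n) \<zeta> = \<zeta>"
    using j k by (auto simp: n_def funpow_mult)
  have s_n: "(s ^^ n) x = x" if "(s ^^ k) x = x" for x
    using that unfolding n_def by (induction j) (auto simp: funpow_add mult.commute)

  interpret fps_ode taylor p N y \<zeta>
    by standard (use taylor_homo in \<open>auto simp: ring_homo_def\<close>)
  have ev0: "ev0 = e0"
    by (simp add: ev0_def[abs_def] e0_def taylor_nth_0)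
  \<comment> \<open>The Bezout identity at the initial data shows that the root
    \<open>\<zeta>\<close> is simple.\<close>
  have "poly (map_poly e0 (u * p + v * pderiv p)) \<zeta> = e0 e"
    by (simp add: e(2) map_poly_pCons e0.zero)
  then have "poly (map_poly e0 v) \<zeta> * poly (map_poly e0 (pderiv p)) \<zeta> = e0 e"
    by (simp add: ring_homo.add[OF e0.map_poly_homo] ring_homo.mult[OF e0.map_poly_homo] \<zeta>)
  then have "poly (map_poly e0 (pderiv p)) \<zeta> \<noteq> 0"
    using nz(2) by auto
  then have "\<exists>!a. init a \<and> ev p a = 0"
    using unique_solution \<zeta> by (simp add: ev0)
  then obtain a where a: "init a" "ev p a = 0"
    and unique: "\<And>b. init b \<Longrightarrow> ev p b = 0 \<Longrightarrow> b = a"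
    by metis

  \<comment> \<open>\<open>T\<close> fixes the Taylor series of the coefficients of \<open>p\<close>
    and the initial data. So \<open>T a\<close> solves the same initial value problem, and
    uniqueness gives \<open>T a = a\<close>.\<close>
  define T where "T = fps_map (t ^^ n)"
  have T: "ring_homo T"
    unfolding T_def by (rule ring_homo_fps_map[OF tk])
  have T_taylor: "T (taylor x) = taylor ((s ^^ n) x)" for x
  proof -
    have "(fps_map t ^^ j) (taylor x) = taylor ((s ^^ j) x)" for j
      by (induction j) (auto simp: fps_map_taylor[OF t])
    then show ?thesis
      by (simp add: T_def fps_map_funpow)
  qed
  have T_arg: "T (arg b i) = arg (T b) i" for b i
    by (auto simp: T_def arg_def fps_map_funpow_deriv[OF tk] intro!: fps_ext simp: t_y ring_homo.zero[OF tk])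
  have "T (mpoly_eval taylor (arg a) (coeff p j)) = mpoly_eval taylor (arg (T a)) (coeff p j)" for j
    unfolding homo_mpoly_eval[OF T] T_arg T_taylor
    by (rule mpoly_eval_cong) (simp add: fixed s_n)
  then have "map_poly T (map_poly (mpoly_eval taylor (arg a)) p) = map_poly (mpoly_eval taylor (arg (T a))) p"
    by (intro poly_eqI) (simp add: coeff_map_poly ring_homo.zero[OF homo] ring_homo.zero[OF T])
  then have "ev p (T a) = T (ev p a)"
    by (simp add: ev_def ring_homo.poly[OF T]) (simp add: T_def fps_map_funpow_deriv[OF tk])
  then have "ev p (T a) = 0"
    by (simp add: a(2) ring_homo.zero[OF T])
  moreover have "init (T a)"
  proof -
    have "(t ^^ n) (fact i) = fact i" for i
      using ring_homo.of_nat[OF tk, of n "fact i"] by simp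
    then show ?thesis
      using a(1) by (simp add: init_def T_def ring_homo_divide[OF tk] t_y n(2))
  qed
  ultimately have "T a = a"
    by (intro unique)
  then have 1: "(fps_map t ^^ n) a = a"
    by (simp add: T_def fps_map_funpow)

  have "dpoly_eval taylor (\<lambda>i. (fps_deriv ^^ i) a) P =
      dpoly_eval taylor ((arg a)(N := (fps_deriv ^^ N) a)) P"
    using P(5) by (intro dpoly_eval_cong) (auto simp: arg_def order.order_iff_strict)
  also have "\<dots> = ev f a"
    unfolding f_def ev_def by (rule eval_dpoly_poly[OF H, symmetric])
  finally have Pf: "dpoly_eval taylor (\<lambda>i. (fps_deriv ^^ i) a) P = ev f a" .
  \<comment> \<open>From \<open>smult d f = p * q\<close> the value of \<open>d\<close> can be
    cancelled, since its constant term \<open>e0 d\<close> is nonzero.\<close>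
  have "mpoly_eval taylor (arg a) d * ev f a = ev p a * ev q a"
    unfolding ev_def poly_mult[symmetric] ring_homo.mult[OF ring_homo.map_poly_homo[OF homo], symmetric]
      d(2)[symmetric] by (simp add: ring_homo.map_poly_smult[OF homo])
  moreover have "mpoly_eval taylor (arg a) d \<noteq> 0"
    using nth_0_mpoly_eval[OF a(1), of d] nz(1) by (auto simp: ev0)
  ultimately have 2: "dpoly_eval taylor (\<lambda>i. (fps_deriv ^^ i) a) P = 0"
    using a(2) by (simp add: Pf)

  have "dpoly_eval taylor (\<lambda>i. (fps_deriv ^^ i) a) G = dpoly_eval taylor (arg a) G"
    using G(3) by (intro dpoly_eval_cong) (auto simp: arg_def)
  also have "\<dots> = mpoly_eval taylor (arg a) (dpoly_mpoly G)"
    by (rule mpoly_eval_dpoly_mpoly[OF H, symmetric])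
  finally have 3: "dpoly_eval taylor (\<lambda>i. (fps_deriv ^^ i) a) G \<noteq> 0"
    using nth_0_mpoly_eval[OF a(1), of "dpoly_mpoly G"] nz(4) by (auto simp: ev0)
  show thesis
    using that[OF n(1) 1 2 3] .
qed

end

section \<open>Extensions of models of DCFA on other types\<close>

text \<open>Laurent series, because an extension has to be a field and power series form only an
  integral domain.\<close>

definition fls_map :: "('a::zero \<Rightarrow> 'a) \<Rightarrow> 'a fls \<Rightarrow> 'a fls" where
  "fls_map t f = Abs_fls (\<lambda>n. t (fls_nth f n))"

lemma fls_nth_map: "t 0 = 0 \<Longrightarrow> fls_nth (fls_map t f) n = t (fls_nth f n)"
  unfolding fls_map_def
  by (rule nth_Abs_fls_lower_bound[of "fls_subdegree f"]) simp

lemma fls_map_fps_to_fls: "t 0 = 0 \<Longrightarrow> fls_map t (fps_to_fls f) = fps_to_fls (fps_map t f)"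
  by (rule fls_eqI) (simp add: fls_nth_map)

lemma fls_map_funpow_fps_to_fls:
  "t 0 = 0 \<Longrightarrow> (fls_map t ^^ n) (fps_to_fls f) = fps_to_fls ((fps_map t ^^ n) f)"
  by (induction n) (auto simp: fls_map_fps_to_fls)

lemma fls_map_deriv:
  fixes t :: "'a::comm_ring_1 \<Rightarrow> 'a"
  assumes "ring_homo t"
  shows "fls_map t (fls_deriv f) = fls_deriv (fls_map t f)"
proof -
  interpret ring_homo t by fact
  have "t (of_int n) = of_int n" for n
    by (cases n) (simp_all add: of_nat uminus diff one)
  then show ?thesis
    by (intro fls_eqI) (simp add: fls_nth_map zero mult add one)
qed

lemma ring_homo_fls_map:
  fixes t :: "'a::field \<Rightarrow> 'a"
  assumes "ring_homo t"
  shows "ring_homo (fls_map t)"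
proof -
  interpret ring_homo t by fact
  have t0: "t x = 0 \<longleftrightarrow> x = 0" for x
    using ring_homo_inj[OF assms] zero by (metis injD)
  \<comment> \<open>An injective \<open>t\<close> keeps subdegrees, so the finite sums for the
    coefficients of a product run over the same indices.\<close>
  have subdegree: "fls_subdegree (fls_map t f) = fls_subdegree f" for f
  proof (cases "f = 0")
    case True
    then have "fls_map t f = 0"
      by (intro fls_eqI) (simp add: fls_nth_map zero)
    then show ?thesis
      using True by simp
  next
    case False
    then show ?thesis
      by (intro fls_subdegree_eqI) (simp_all add: fls_nth_map zero t0)
  qed
  show ?thesis
  proof
    show "fls_map t 1 = 1"
      by (rule fls_eqI) (simp add: fls_nth_map zero one)
    show "fls_map t (f + g) = fls_map t f + fls_map t g" for f g
      by (rule fls_eqI) (simp add: fls_nth_map zero add)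
    show "fls_map t (f * g) = fls_map t f * fls_map t g" for f g
      by (rule fls_eqI) (simp add: fls_nth_map zero sum mult fls_times_nth(2) subdegree)
  qed
qed

lemma bij_fls_map:
  fixes t :: "'a::field \<Rightarrow> 'a"
  assumes "ring_homo t" "bij t"
  shows "bij (fls_map t)"
proof (rule o_bij)
  have t0: "t 0 = 0" and t0': "inv_into UNIV t 0 = 0"
    using assms by (auto simp: ring_homo.zero inv_f_eq bij_is_inj)
  show "fls_map (inv_into UNIV t) \<circ> fls_map t = id"
    using assms(2) by (auto simp: fun_eq_iff fls_nth_map t0 t0' bij_is_inj intro!: fls_eqI)
  show "fls_map t \<circ> fls_map (inv_into UNIV t) = id"
    using assms(2) by (auto simp: fun_eq_iff fls_nth_map t0 t0' bij_is_surj surj_f_inv_f intro!: fls_eqI)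
qed

unbundle cardinal_syntax

section \<open>Cardinality of generated substructures\<close>

lemma card_of_Un_ordLeq_if_infinite:
  assumes "infinite C" "|A| \<le>o |C|" "|B| \<le>o |C|"
  shows "|A \<union> B| \<le>o |C|"
proof -
  have "|\<Union>n::nat. if n = 0 then A else B| \<le>o |C|"
    using assms infinite_iff_card_of_nat by (intro card_of_UNION_ordLeq_infinite) auto
  moreover have "(\<Union>n::nat. if n = 0 then A else B) = A \<union> B"
    by (auto split: if_splits)
  ultimately show ?thesis by simp
qed

text \<open>The closure step is iterated countably often. Two elements of the union lie in a common
  stage, and each stage keeps the cardinal bound.\<close>

lemma countable_operations_hull:
  fixes f :: "nat \<Rightarrow> 'l \<Rightarrow> 'l \<Rightarrow> 'l" and C :: "'c set"
  assumes C: "infinite C" and B: "|B| \<le>o |C|"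
  obtains M where "B \<subseteq> M" "\<forall>i. \<forall>x\<in>M. \<forall>y\<in>M. f i x y \<in> M" "|M| \<le>o |C|"
proof -
  define step where "step S = S \<union> (\<Union>i. \<Union>x\<in>S. \<Union>y\<in>S. {f i x y})" for S
  define M where "M n = (step ^^ n) B" for n
  have nat: "|UNIV :: nat set| \<le>o |C|"
    using C infinite_iff_card_of_nat by blast
  have single: "|{x}| \<le>o |C|" for x :: 'l
    using C by (intro card_of_singl_ordLeq) auto
  have step: "|step S| \<le>o |C|" if "|S| \<le>o |C|" for S
    unfolding step_def
    by (rule card_of_Un_ordLeq_if_infinite[OF C that],
        rule card_of_UNION_ordLeq_infinite[OF C nat], rule ballI,
        rule card_of_UNION_ordLeq_infinite[OF C that], rule ballI,
        rule card_of_UNION_ordLeq_infinite[OF C that], rule ballI, rule single)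
  have "|M n| \<le>o |C|" for n
    unfolding M_def by (induction n) (simp_all add: B step)
  then have card: "|\<Union>n. M n| \<le>o |C|"
    by (intro card_of_UNION_ordLeq_infinite[OF C nat]) blast
  have base: "B \<subseteq> (\<Union>n. M n)"
    using UN_upper[of 0 UNIV M] by (simp add: M_def)
  have closed: "f i x y \<in> (\<Union>n. M n)" if "x \<in> (\<Union>n. M n)" "y \<in> (\<Union>n. M n)" for i x y
  proof -
    obtain m n where "x \<in> M m" "y \<in> M n"
      using \<open>x \<in> (\<Union>n. M n)\<close> \<open>y \<in> (\<Union>n. M n)\<close> by blast
    moreover have mono: "M m \<subseteq> M (m + k)" for m k
      by (induction k) (auto simp: M_def step_def)
    ultimately have "x \<in> M (m + n)" "y \<in> M (m + n)"
      using mono[of m n] mono[of n m] by (auto simp: add.commute)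
    then have "f i x y \<in> M (Suc (m + n))"
      by (auto simp: M_def step_def)
    then show ?thesis by blast
  qed
  show thesis
    by (rule that[OF base _ card]) (use closed in blast)
qed

section \<open>Fields on types viewed as ring records\<close>

lemma ring_of_type_algebra_simps:
  "carrier (ring_of_type_algebra :: 'l::field ring) = UNIV"
  "mult (ring_of_type_algebra :: 'l::field ring) x y = x * y"
  "one (ring_of_type_algebra :: 'l::field ring) = 1"
  "ring.zero (ring_of_type_algebra :: 'l::field ring) = 0"
  "ring.add (ring_of_type_algebra :: 'l::field ring) x y = x + y"
  by (simp_all add: ring_of_type_algebra_def)

lemma a_inv_ring_of_type_algebra: "a_inv (ring_of_type_algebra :: 'l::field ring) x = - x"
proof -
  interpret R: field "ring_of_type_algebra :: 'l ring" by auto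
  show ?thesis
    by (rule R.minus_equality) (simp_all add: ring_of_type_algebra_simps)
qed

lemma m_inv_ring_of_type_algebra:
  assumes "x \<noteq> 0"
  shows "m_inv (ring_of_type_algebra :: 'l::field ring) x = inverse x"
proof -
  interpret R: field "ring_of_type_algebra :: 'l ring" by auto
  show ?thesis
    using assms by (intro R.comm_inv_char) (simp_all add: ring_of_type_algebra_simps)
qed

lemma subfield_ring_of_type_algebra:
  fixes M :: "'l::field set"
  assumes "1 \<in> M" "\<And>x y. x \<in> M \<Longrightarrow> y \<in> M \<Longrightarrow> x + y \<in> M" "\<And>x y. x \<in> M \<Longrightarrow> y \<in> M \<Longrightarrow> x * y \<in> M"
    "\<And>x. x \<in> M \<Longrightarrow> - x \<in> M" "\<And>x. x \<in> M \<Longrightarrow> inverse x \<in> M"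
  shows "subfield M ring_of_type_algebra"
proof -
  interpret R: field "ring_of_type_algebra :: 'l ring" by auto
  show ?thesis
    using assms
    by (intro R.subfieldI' R.subringI)
      (auto simp: ring_of_type_algebra_simps a_inv_ring_of_type_algebra m_inv_ring_of_type_algebra)
qed

lemma ring_hom_of_nat:
  fixes h :: "'a \<Rightarrow> 'l::field"
  assumes "ring K" "h \<in> ring_hom K ring_of_type_algebra"
  shows "h (add_pow K n \<one>\<^bsub>K\<^esub>) = of_nat n"
proof -
  interpret K: ring K by fact
  interpret R: field "ring_of_type_algebra :: 'l ring" by auto
  interpret ring_hom_ring K "ring_of_type_algebra :: 'l ring" h
    by (rule ring_hom_ringI2) (use assms R.ring_axioms in auto)
  show ?thesis
    using hom_zero hom_one by (induction n) (auto simp: ring_of_type_algebra_simps add.commute)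
qed

lemma (in dd_field) s_inj: "s x = s y \<longleftrightarrow> x = y"
  using s_bij by (auto simp: bij_def inj_eq)

text \<open>Loewenheim-Skolem: the extension may live on any type, since it is enough to consider the
  subfield generated by the image of \<open>K\<close> and the values of the variables.\<close>

theorem DCFA_existentially_closed:
  fixes K :: "('a, 'm) ring_scheme" and D' s' :: "'l::field_char_0 \<Rightarrow> 'l"
  assumes K: "DCFA_model K D s" and L: "dd_field D' s'"
    and h: "h \<in> ring_hom K ring_of_type_algebra"
    and h_D: "\<And>x. x \<in> carrier K \<Longrightarrow> h (D x) = D' (h x)"
    and h_s: "\<And>x. x \<in> carrier K \<Longrightarrow> h (s x) = s' (h x)"
    and p: "set_sd_formula p \<subseteq> carrier K" "holds ring_of_type_algebra D' s' h v p"
  obtains w where "\<forall>i. w i \<in> carrier K" "holds K D s id w p"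
proof -
  interpret K: difference_differential_field K D s
    using K by (simp add: DCFA_model_def)
  interpret L: dd_field D' s' by fact
  have of_nat: "h (add_pow K n \<one>\<^bsub>K\<^esub>) = of_nat n" for n
    using K.ring_axioms h by (rule ring_hom_of_nat)
  have inf: "infinite (carrier K)"
  proof
    assume "finite (carrier K)"
    then have "finite (h ` carrier K)" by simp
    moreover have "range (of_nat :: nat \<Rightarrow> 'l) \<subseteq> h ` carrier K"
      by (auto simp flip: of_nat)
    ultimately show False
      by (meson finite_imageD finite_subset infinite_UNIV_nat inj_of_nat)
  qed
  \<comment> \<open>The inverse of \<open>s'\<close> is among the operations so that
    \<open>s'\<close> remains surjective on \<open>M\<close>. Unary operations ignore
    \<open>y\<close>.\<close>
  define f where "f i x y = (if i = 0 then x + y else if i = 1 then x * y else if i = 2 then - x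
    else if i = 3 then inverse x else if i = 4 then D' x else if i = 5 then s' x
    else inv_into UNIV s' x)" for i :: nat and x y :: 'l
  have "|UNIV :: nat set| \<le>o |carrier K|"
    using inf infinite_iff_card_of_nat by blast
  then have "|h ` carrier K \<union> range v| \<le>o |carrier K|"
    by (intro card_of_Un_ordLeq_if_infinite[OF inf card_of_image] ordLeq_transitive[OF card_of_image])
  then obtain M where M: "h ` carrier K \<union> range v \<subseteq> M" "\<forall>i. \<forall>x\<in>M. \<forall>y\<in>M. f i x y \<in> M"
      "|M| \<le>o |carrier K|"
    by (rule countable_operations_hull[OF inf, of _ f])
  have M_ops: "x + y \<in> M" "x * y \<in> M" "- x \<in> M" "inverse x \<in> M" "D' x \<in> M" "s' x \<in> M"
      "inv_into UNIV s' x \<in> M" if "x \<in> M" "y \<in> M" for x y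
  proof -
    have "f i x y \<in> M" for i
      using M(2) that by blast
    from this[of 0] this[of 1] this[of 2] this[of 3] this[of 4] this[of 5] this[of 6]
    show "x + y \<in> M" "x * y \<in> M" "- x \<in> M" "inverse x \<in> M" "D' x \<in> M" "s' x \<in> M"
        "inv_into UNIV s' x \<in> M"
      by (simp_all add: f_def)
  qed
  have diff_M: "x - y \<in> M" if "x \<in> M" "y \<in> M" for x y
    using M_ops(1)[OF that(1) M_ops(3)[OF that(2) that(2)]] by simp
  have h_M: "h x \<in> M" if "x \<in> carrier K" for x
    using M(1) that by auto
  have v_M: "v i \<in> M" for i
    using M(1) by auto
  have nat_M: "of_nat n \<in> M" for n
    unfolding of_nat[symmetric] by (rule h_M) simp
  have zero_M: "0 \<in> M" and one_M: "1 \<in> M"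
    using nat_M[of 0] nat_M[of 1] by simp_all
  \<comment> \<open>The injection \<open>j\<close> moves the structure on \<open>M\<close> to a
    subset of the type \<open>'a\<close>, over which \<open>DCFA_model\<close> quantifies.\<close>
  obtain j where j: "inj_on j M" "j ` M \<subseteq> carrier K"
    using M(3) unfolding card_of_ordLeq[symmetric] by (elim exE conjE)
  have j_eq: "j x = j y \<longleftrightarrow> x = y" if "x \<in> M" "y \<in> M" for x y
    using that by (rule inj_on_eq_iff[OF j(1)])
  have j_inv: "inv_into M j (j x) = x" if "x \<in> M" for x
    using j(1) that by simp

  define L0 where "L0 = (ring_of_type_algebra :: 'l ring)\<lparr>carrier := M\<rparr>"
  interpret R: field "ring_of_type_algebra :: 'l ring" by auto
  interpret L0: field L0
    unfolding L0_def using M_ops one_M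
    by (intro R.subfield_iff(2) subfield_ring_of_type_algebra) auto
  define L1 where "L1 = image_ring j L0"
  interpret L1: field L1
    unfolding L1_def using j(1) by (intro L0.inj_imp_image_ring_is_field) (simp add: L0_def)
  have carrier_L1: "carrier L1 = j ` M"
    by (simp add: L1_def image_ring_carrier L0_def)
  have L1: "\<one>\<^bsub>L1\<^esub> = j 1" "\<zero>\<^bsub>L1\<^esub> = j 0"
    by (simp_all add: L1_def image_ring_one image_ring_zero L0_def ring_of_type_algebra_simps)
  have L1_ops: "j x \<oplus>\<^bsub>L1\<^esub> j y = j (x + y)" "j x \<otimes>\<^bsub>L1\<^esub> j y = j (x * y)" if "x \<in> M" "y \<in> M" for x y
    using that
    by (simp_all add: L1_def image_ring_def image_group_def monoid.defs L0_def j_inv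
        ring_of_type_algebra_simps)
  have L1_uminus: "\<ominus>\<^bsub>L1\<^esub> j x = j (- x)" if "x \<in> M" for x
    using that by (intro L1.minus_equality) (auto simp: carrier_L1 L1_ops L1 M_ops)
  define D1 where "D1 x = j (D' (inv_into M j x))" for x
  define s1 where "s1 x = j (s' (inv_into M j x))" for x
  have D1: "D1 (j x) = j (D' x)" and s1: "s1 (j x) = j (s' x)" if "x \<in> M" for x
    using that by (simp_all add: D1_def s1_def j_inv)
  have s'_surj: "s' (inv_into UNIV s' x) = x" for x
    using L.s_bij by (simp add: bij_is_surj surj_f_inv_f)
  interpret L1: difference_differential_field L1 D1 s1
  proof
    fix n :: nat assume "n > 0"
    have "add_pow L1 n \<one>\<^bsub>L1\<^esub> = j (of_nat n)"
      by (induction n) (auto simp: L1 L1_ops nat_M one_M add.commute)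
    then show "add_pow L1 n \<one>\<^bsub>L1\<^esub> \<noteq> \<zero>\<^bsub>L1\<^esub>"
      using \<open>n > 0\<close> j_eq[OF nat_M nat_M, of n 0] by (simp add: L1)
  next
    show "s1 \<in> ring_iso L1 L1"
    proof (rule ring_iso_memI)
      have "s1 ` j ` M = j ` M"
      proof
        show "j ` M \<subseteq> s1 ` j ` M"
        proof
          fix y assume "y \<in> j ` M"
          then obtain x where x: "x \<in> M" "y = j x" by blast
          then have "y = s1 (j (inv_into UNIV s' x))"
            using M_ops(7)[OF x(1) x(1)] by (simp add: s1 s'_surj)
          then show "y \<in> s1 ` j ` M"
            using M_ops(7)[OF x(1) x(1)] by blast
        qed
      qed (auto simp: s1 M_ops)
      moreover have "inj_on s1 (j ` M)"
        by (auto intro!: inj_onI simp: s1 j_eq M_ops L.s_inj)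
      ultimately show "bij_betw s1 (carrier L1) (carrier L1)"
        by (simp add: bij_betw_def carrier_L1)
    qed (use one_M in \<open>auto simp: carrier_L1 s1 L1_ops L1 M_ops ring_homo.add[OF L.s_homo]
        ring_homo.mult[OF L.s_homo] ring_homo.one[OF L.s_homo]\<close>)
  qed (auto simp: carrier_L1 D1 s1 L1_ops M_ops L.D_add L.D_mult L.s_D)

  have terms: "eval_term ring_of_type_algebra D' s' h v t \<in> M \<and>
      eval_term L1 D1 s1 (\<lambda>x. j (h x)) (\<lambda>i. j (v i)) t = j (eval_term ring_of_type_algebra D' s' h v t)"
    if "set_sd_term t \<subseteq> carrier K" for t
    using that zero_M one_M
    by (induction t)
      (auto simp: L1 L1_ops D1 s1 a_minus_def L1_uminus h_M v_M M_ops diff_M ring_of_type_algebra_simps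
        a_inv_ring_of_type_algebra)
  have "holds L1 D1 s1 (\<lambda>x. j (h x)) (\<lambda>i. j (v i)) q \<longleftrightarrow> holds ring_of_type_algebra D' s' h v q"
    if "set_sd_formula q \<subseteq> carrier K" for q
    using that by (induction q) (auto simp: terms j_eq)
  then have "holds L1 D1 s1 (\<lambda>x. j (h x)) (\<lambda>i. j (v i)) p"
    using p by blast
  moreover have "(\<lambda>x. j (h x)) \<in> ring_hom K L1"
    using h by (intro ring_hom_memI)
      (auto simp: carrier_L1 h_M L1_ops L1 ring_hom_def ring_of_type_algebra_simps)
  ultimately have "\<exists>w. (\<forall>i. w i \<in> carrier K) \<and> holds K D s id w p"
    using K p(1) L1.difference_differential_field_axioms v_M h_M
    unfolding DCFA_model_def
    by (elim conjE allE[of _ p] allE[of _ L1] allE[of _ D1] allE[of _ s1] allE[of _ "\<lambda>x. j (h x)"]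
        allE[of _ "\<lambda>i. j (v i)"]) (auto simp: carrier_L1 h_D h_s D1 s1)
  then show thesis
    using that by blast
qed

section \<open>Models of DCFA that are types\<close>

lemma ring_of_type_algebra_nat_pow:
  "x [^]\<^bsub>(ring_of_type_algebra :: 'l::field ring)\<^esub> (n::nat) = x ^ n"
proof -
  interpret R: field "ring_of_type_algebra :: 'l ring" by auto
  show ?thesis
    by (induction n) (simp_all add: ring_of_type_algebra_simps mult.commute)
qed

lemma ring_of_type_algebra_finsum:
  "finsum (ring_of_type_algebra :: 'l::field ring) f A = sum f A"
proof -
  interpret R: field "ring_of_type_algebra :: 'l ring" by auto
  show ?thesis
    by (induction A rule: infinite_finite_induct) (simp_all add: ring_of_type_algebra_simps)
qed

lemma ring_of_type_algebra_finprod: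
  "finprod (ring_of_type_algebra :: 'l::field ring) f A = prod f A"
proof -
  interpret R: field "ring_of_type_algebra :: 'l ring" by auto
  show ?thesis
    by (induction A rule: infinite_finite_induct) (simp_all add: ring_of_type_algebra_simps)
qed

text \<open>Multiples of periods are periods, so finitely many periodic elements, such as the
  coefficients of a differential polynomial, share one.\<close>

lemma common_period:
  assumes "finite A" "\<And>x. x \<in> A \<Longrightarrow> \<exists>n>0. (f ^^ n) x = x"
  obtains k where "k > (0::nat)" "\<And>x. x \<in> A \<Longrightarrow> (f ^^ k) x = x"
proof -
  have multiple: "(f ^^ (n * k)) x = x" if "(f ^^ n) x = x" for n k x
    using that by (induction k) (auto simp: funpow_add)
  have "\<exists>k>0. \<forall>x\<in>A. (f ^^ k) x = x"
    using assms
  proof (induction A rule: finite_induct)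
    case (insert a A)
    obtain n where "n > 0" "(f ^^ n) a = a"
      using insert.prems by blast
    moreover obtain k where "k > 0" "\<forall>x\<in>A. (f ^^ k) x = x"
      using insert.IH insert.prems by blast
    ultimately show ?case
      using multiple[of n a k] multiple[of k _ n]
      by (intro exI[of _ "n * k"]) (auto simp: mult.commute)
  qed auto
  then show thesis
    using that by blast
qed

lemma (in ring) indexed_pset_finite_support:
  assumes "P \<in> indexed_pset I (carrier R)"
  shows "finite {m. P m \<noteq> \<zero>}" "P m \<in> carrier R"
proof -
  show "P m \<in> carrier R"
    using carrier_coeffE[OF indexed_pset_in_carrier[OF subset_refl assms]] .
  show "finite {m. P m \<noteq> \<zero>}"
    using assms
  proof induction
    case (indexed_const k)
    show ?case
      by (rule finite_subset[of _ "{{#}}"]) (auto simp: indexed_const_def)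
  next
    case (indexed_padd P Q)
    show ?case
      by (rule finite_subset[OF _ finite_UnI[OF indexed_padd.IH]]) (auto simp: indexed_padd_def)
  next
    case (indexed_pmult P i)
    have "{m. (P \<Otimes> i) m \<noteq> \<zero>} \<subseteq> add_mset i ` {m. P m \<noteq> \<zero>}"
    proof
      fix m assume "m \<in> {m. (P \<Otimes> i) m \<noteq> \<zero>}"
      then have "i \<in># m" "P (m - {#i#}) \<noteq> \<zero>"
        by (auto simp: indexed_pmult_def split: if_splits)
      then show "m \<in> add_mset i ` {m. P m \<noteq> \<zero>}"
        by (intro image_eqI[of _ _ "m - {#i#}"]) auto
    qed
    then show ?case
      using indexed_pmult.IH by (meson finite_imageI finite_subset)
  qed
qed

section \<open>Differential polynomials as terms of the language\<close>

fun monom_term :: "nat list \<Rightarrow> 'a sd_term" where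
  "monom_term [] = One"
| "monom_term (i # is) = Times ((Deriv ^^ i) (Var 0)) (monom_term is)"

fun dpoly_term :: "(nat multiset \<Rightarrow> 'a) \<Rightarrow> nat multiset list \<Rightarrow> 'a sd_term" where
  "dpoly_term P [] = Zero"
| "dpoly_term P (m # ms) =
    Plus (Times (Param (P m)) (monom_term (sorted_list_of_multiset m))) (dpoly_term P ms)"

lemma eval_Deriv_funpow: "eval_term R D s h v ((Deriv ^^ i) t) = (D ^^ i) (eval_term R D s h v t)"
  by (induction i) auto

lemma eval_Sigma_funpow: "eval_term R D s h v ((Sigma ^^ i) t) = (s ^^ i) (eval_term R D s h v t)"
  by (induction i) auto

lemma eval_monom_term:
  fixes D :: "'l::field \<Rightarrow> 'l"
  shows "eval_term ring_of_type_algebra D s h v (monom_term is) = (\<Prod>i\<in>#mset is. (D ^^ i) (v 0))"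
  by (induction "is") (auto simp: ring_of_type_algebra_simps eval_Deriv_funpow)

lemma eval_dpoly_term:
  fixes D :: "'l::field \<Rightarrow> 'l"
  assumes "distinct ms"
  shows "eval_term ring_of_type_algebra D s h v (dpoly_term P ms) =
    (\<Sum>m\<in>set ms. h (P m) * (\<Prod>i\<in>#m. (D ^^ i) (v 0)))"
  using assms by (induction ms) (auto simp: ring_of_type_algebra_simps eval_monom_term)

lemma set_Deriv_funpow: "set_sd_term ((Deriv ^^ i) t) = set_sd_term t"
  by (induction i) auto

lemma set_Sigma_funpow: "set_sd_term ((Sigma ^^ i) t) = set_sd_term t"
  by (induction i) auto

lemma set_dpoly_term: "set_sd_term (dpoly_term P ms) \<subseteq> P ` set ms"
proof -
  have "set_sd_term (monom_term is :: 'a sd_term) = {}" for "is"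
    by (induction "is") (auto simp: set_Deriv_funpow)
  then show ?thesis
    by (induction ms) auto
qed

text \<open>The isomorphism \<open>\<kappa>\<close> moves the model to a whole type, where the
  constructions for \<open>dd_field\<close> apply.\<close>

locale typed_DCFA =
  fixes K :: "('a, 'm) ring_scheme" and D s :: "'a \<Rightarrow> 'a" and \<kappa> :: "'a \<Rightarrow> 'k::field_char_0"
  assumes model: "DCFA_model K D s"
    and iso: "\<kappa> \<in> ring_iso K ring_of_type_algebra"
begin

sublocale K: difference_differential_field K D s
  using model by (simp add: DCFA_model_def)

sublocale T: field "ring_of_type_algebra :: 'k ring"
  by auto

sublocale \<kappa>: ring_hom_cring K "ring_of_type_algebra :: 'k ring" \<kappa>
  by (intro ring_hom_cring.intro ring_hom_cring_axioms.intro K.cring_axioms T.cring_axioms)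
    (use iso in \<open>simp add: ring_iso_def\<close>)

declare ring_of_type_algebra_simps [simp] a_inv_ring_of_type_algebra [simp]
  ring_of_type_algebra_nat_pow [simp]

lemma \<kappa>_simps:
  assumes "x \<in> carrier K" "y \<in> carrier K"
  shows "\<kappa> (x \<oplus>\<^bsub>K\<^esub> y) = \<kappa> x + \<kappa> y" "\<kappa> (x \<otimes>\<^bsub>K\<^esub> y) = \<kappa> x * \<kappa> y"
    "\<kappa> (x \<ominus>\<^bsub>K\<^esub> y) = \<kappa> x - \<kappa> y"
  using assms by (simp_all add: ring_of_type_algebra_simps a_minus_def a_inv_ring_of_type_algebra)

lemma \<kappa>_0: "\<kappa> \<zero>\<^bsub>K\<^esub> = 0" and \<kappa>_1: "\<kappa> \<one>\<^bsub>K\<^esub> = 1"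
  using \<kappa>.hom_zero \<kappa>.hom_one by (simp_all add: ring_of_type_algebra_simps)

lemma \<kappa>_bij: "bij_betw \<kappa> (carrier K) UNIV"
  using iso by (simp add: ring_iso_def ring_of_type_algebra_simps)

lemma \<kappa>_eq: "x \<in> carrier K \<Longrightarrow> y \<in> carrier K \<Longrightarrow> \<kappa> x = \<kappa> y \<longleftrightarrow> x = y"
  using \<kappa>_bij by (meson bij_betw_def inj_on_eq_iff)

lemma \<kappa>_eq_0: "x \<in> carrier K \<Longrightarrow> \<kappa> x = 0 \<longleftrightarrow> x = \<zero>\<^bsub>K\<^esub>"
  using \<kappa>_eq[of x "\<zero>\<^bsub>K\<^esub>"] by (simp add: ring_of_type_algebra_simps)

lemma \<kappa>_pow: "x \<in> carrier K \<Longrightarrow> \<kappa> (x [^]\<^bsub>K\<^esub> (n::nat)) = \<kappa> x ^ n"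
  by (induction n) (simp_all add: \<kappa>_simps ring_of_type_algebra_simps mult.commute)

definition \<iota> :: "'k \<Rightarrow> 'a" where "\<iota> = inv_into (carrier K) \<kappa>"

lemma \<iota>_closed: "\<iota> y \<in> carrier K"
  unfolding \<iota>_def using \<kappa>_bij by (intro inv_into_into) (simp add: bij_betw_def)

lemma \<kappa>_\<iota>: "\<kappa> (\<iota> y) = y"
  unfolding \<iota>_def using \<kappa>_bij by (intro f_inv_into_f) (simp add: bij_betw_def)

lemma \<iota>_\<kappa>: "x \<in> carrier K \<Longrightarrow> \<iota> (\<kappa> x) = x"
  using \<kappa>_eq[OF \<iota>_closed] \<kappa>_\<iota> by blast

definition D0 :: "'k \<Rightarrow> 'k" where "D0 y = \<kappa> (D (\<iota> y))"

definition s0 :: "'k \<Rightarrow> 'k" where "s0 y = \<kappa> (s (\<iota> y))"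

lemma s_closed: "x \<in> carrier K \<Longrightarrow> s x \<in> carrier K"
  using K.automorphism by (auto simp: ring_iso_def ring_hom_def)

lemma \<kappa>_D: "x \<in> carrier K \<Longrightarrow> \<kappa> (D x) = D0 (\<kappa> x)"
  by (simp add: D0_def \<iota>_\<kappa>)

lemma \<kappa>_s: "x \<in> carrier K \<Longrightarrow> \<kappa> (s x) = s0 (\<kappa> x)"
  by (simp add: s0_def \<iota>_\<kappa>)

lemma funpow_D: "x \<in> carrier K \<Longrightarrow> (D ^^ n) x \<in> carrier K \<and> \<kappa> ((D ^^ n) x) = (D0 ^^ n) (\<kappa> x)"
  by (induction n) (auto simp: \<kappa>_D K.deriv_closed)

lemma funpow_s: "x \<in> carrier K \<Longrightarrow> (s ^^ n) x \<in> carrier K \<and> \<kappa> ((s ^^ n) x) = (s0 ^^ n) (\<kappa> x)"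
  by (induction n) (auto simp: \<kappa>_s s_closed)

lemma \<iota>_ops: "\<iota> (x + y) = \<iota> x \<oplus>\<^bsub>K\<^esub> \<iota> y" "\<iota> (x * y) = \<iota> x \<otimes>\<^bsub>K\<^esub> \<iota> y" "\<iota> 1 = \<one>\<^bsub>K\<^esub>"
  using \<iota>_\<kappa>[of "\<iota> x \<oplus>\<^bsub>K\<^esub> \<iota> y"] \<iota>_\<kappa>[of "\<iota> x \<otimes>\<^bsub>K\<^esub> \<iota> y"] \<iota>_\<kappa>[of "\<one>\<^bsub>K\<^esub>"]
  by (simp_all add: \<kappa>_simps \<kappa>_\<iota> \<kappa>_1 \<iota>_closed)

sublocale dd: dd_field D0 s0
proof
  have s_hom: "s \<in> ring_hom K K" and s_bij: "bij_betw s (carrier K) (carrier K)"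
    using K.automorphism by (auto simp: ring_iso_def)
  show "D0 (x + y) = D0 x + D0 y" "D0 (x * y) = D0 x * y + x * D0 y" for x y
    by (simp_all add: D0_def \<iota>_ops K.deriv_add K.deriv_mult K.deriv_closed \<iota>_closed \<kappa>_simps \<kappa>_\<iota>)
  show "s0 (x + y) = s0 x + s0 y" "s0 (x * y) = s0 x * s0 y" "s0 1 = 1" for x y
    using ring_hom_add[OF s_hom \<iota>_closed \<iota>_closed, of x y] ring_hom_mult[OF s_hom \<iota>_closed \<iota>_closed, of x y]
      ring_hom_one[OF s_hom]
    by (simp_all add: s0_def \<iota>_ops \<kappa>_simps s_closed \<iota>_closed \<kappa>_1)
  show "bij s0"
  proof -
    have "bij_betw \<iota> UNIV (carrier K)"
      unfolding \<iota>_def using \<kappa>_bij by (rule bij_betw_inv_into)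
    from bij_betw_trans[OF this bij_betw_trans[OF s_bij \<kappa>_bij]]
    show ?thesis
      by (simp add: s0_def[abs_def] o_def)
  qed
  show "s0 (D0 x) = D0 (s0 x)" for x
    by (simp add: s0_def D0_def \<iota>_\<kappa> s_closed K.deriv_closed \<iota>_closed K.commute)
qed

text \<open>Coefficient lists start with the leading coefficient for \<open>K.eval\<close> and with
  the constant term for \<open>Poly\<close>, hence \<open>rev\<close>.\<close>

lemma \<kappa>_eval:
  assumes "set xs \<subseteq> carrier K" "x \<in> carrier K"
  shows "K.eval xs x \<in> carrier K \<and> \<kappa> (K.eval xs x) = poly (Poly (rev (map \<kappa> xs))) (\<kappa> x)"
  using assms
  by (induction xs)
    (auto simp: \<kappa>_0 \<kappa>_simps Poly_append poly_monom \<kappa>_pow ring_of_type_algebra_simps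
      K.eval_in_carrier)

section \<open>The fixed field and its relative algebraic closure\<close>

definition F :: "'a set" where "F = Fix K s"

lemma F_iff: "x \<in> F \<longleftrightarrow> x \<in> carrier K \<and> s0 (\<kappa> x) = \<kappa> x"
  using \<kappa>_eq[of "s x" x] by (auto simp: F_def Fix_def s_closed \<kappa>_s)

lemma F_closed: "F \<subseteq> carrier K"
  by (auto simp: F_iff)

lemma subfield_F: "subfield F K"
proof (rule K.subfieldI'[OF K.subringI])
  have s0: "s0 (- y) = - s0 y" "s0 1 = 1" "s0 (x + y) = s0 x + s0 y" "s0 (x * y) = s0 x * s0 y"
    "s0 (1 / y) = 1 / s0 y" for x y
    using ring_homo_divide[OF dd.s_homo, of 1 y]
    by (simp_all add: ring_homo.uminus[OF dd.s_homo] ring_homo.one[OF dd.s_homo]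
        ring_homo.add[OF dd.s_homo] ring_homo.mult[OF dd.s_homo])
  show "\<ominus>\<^bsub>K\<^esub> x \<in> F" if "x \<in> F" for x
    using that by (simp add: F_iff a_inv_ring_of_type_algebra s0)
  show "m_inv K x \<in> F" if "x \<in> F - {\<zero>\<^bsub>K\<^esub>}" for x
  proof -
    have x: "x \<in> Units K" "x \<in> carrier K" "s0 (\<kappa> x) = \<kappa> x"
      using that by (auto simp: F_iff K.field_Units)
    then have "\<kappa> x * \<kappa> (m_inv K x) = 1"
      using \<kappa>_simps(2)[of x "m_inv K x"] by (simp add: \<kappa>_1)
    then have "\<kappa> (m_inv K x) = 1 / \<kappa> x"
      by (metis mult_zero_left nonzero_mult_div_cancel_left zero_neq_one)
    then show ?thesis
      using x by (simp add: F_iff s0)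
  qed
qed (auto simp: F_iff \<kappa>_1 \<kappa>_simps ring_homo.one[OF dd.s_homo] ring_homo.add[OF dd.s_homo]
    ring_homo.mult[OF dd.s_homo])

text \<open>A polynomial over the fixed field has its finitely many roots permuted by the
  automorphism, so the orbit of \<open>x\<close> is a finite cycle.\<close>

lemma algebraic_imp_periodic:
  assumes x: "x \<in> carrier K" and alg: "(K.algebraic over F) x"
  shows "\<exists>n>0. (s ^^ n) x = x"
proof -
  interpret s0: ring_homo s0 by (rule dd.s_homo)
  obtain p where p: "p \<in> carrier (F[X]\<^bsub>K\<^esub>)" "p \<noteq> []" "K.eval p x = \<zero>\<^bsub>K\<^esub>"
    using K.algebraicE[OF subfieldE(1)[OF subfield_F] x alg] .
  have set_p: "set p \<subseteq> F" and lead_p: "hd p \<noteq> \<zero>\<^bsub>K\<^esub>"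
    using p(1,2) by (auto simp: univ_poly_def polynomial_def)
  define q where "q = Poly (rev (map \<kappa> p))"
  have last: "last (rev (map \<kappa> p)) \<noteq> 0"
    using p(2) lead_p set_p F_closed by (simp add: last_rev hd_map) (meson \<kappa>_eq_0 hd_in_set subsetD)
  have "q \<noteq> 0"
  proof
    assume "q = 0"
    then obtain n where n: "rev (map \<kappa> p) = replicate n 0"
      by (auto simp: q_def Poly_eq_0)
    then have "length p = n"
      by (metis length_map length_replicate length_rev)
    then have "n \<noteq> 0"
      using p(2) by auto
    then show False
      using last unfolding n by simp
  qed
  have "s0 (\<kappa> c) = \<kappa> c" if "c \<in> set p" for c
    using that set_p by (auto simp: F_iff)
  then have "s0 (rev (map \<kappa> p) ! i) = rev (map \<kappa> p) ! i" if "i < length p" for i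
    using that by (simp add: rev_nth)
  then have "map_poly s0 q = q"
    unfolding q_def by (intro poly_eqI) (simp add: coeff_map_poly s0.zero nth_default_def)
  then have root: "poly q (s0 z) = 0" if "poly q z = 0" for z
    using s0.poly[of q z] that by (simp add: s0.zero)
  have "poly q (\<kappa> x) = 0"
    using \<kappa>_eval[of p x] set_p F_closed x p(3) by (simp add: q_def \<kappa>_0)
  then have "poly q ((s0 ^^ n) (\<kappa> x)) = 0" for n
    by (induction n) (auto simp: root)
  then have "{z. \<exists>n. z = (s0 ^^ n) (\<kappa> x)} \<subseteq> {z. poly q z = 0}"
    by auto
  then have "finite {z. \<exists>n. z = (s0 ^^ n) (\<kappa> x)}"
    using poly_roots_finite[OF \<open>q \<noteq> 0\<close>] finite_subset by blast
  then obtain n where "n > 0" "(s0 ^^ n) (\<kappa> x) = \<kappa> x"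
    using funpow_inj_finite[of s0 "\<kappa> x"] dd.s_bij by (auto simp: bij_is_inj)
  then show ?thesis
    using funpow_s[OF x, of n] \<kappa>_eq[of "(s ^^ n) x" x] x by auto
qed

text \<open>The product of the linear factors at \<open>x\<close>, \<open>s x\<close>, ..., taken
  over one period, is invariant because its factors are permuted cyclically. Its coefficients
  therefore lie in \<open>F\<close>.\<close>

lemma periodic_imp_algebraic:
  assumes x: "x \<in> carrier K" and n: "n > 0" "(s ^^ n) x = x"
  shows "(K.algebraic over F) x"
proof -
  interpret s0: ring_homo s0 by (rule dd.s_homo)
  interpret map: ring_homo "map_poly s0" by (rule s0.map_poly_homo)
  define q where "q = (\<Prod>i<n. [:- (s0 ^^ i) (\<kappa> x), 1:])"
  have per: "(s0 ^^ n) (\<kappa> x) = \<kappa> x"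
    using funpow_s[OF x, of n] n(2) by simp
  have "map_poly s0 q = (\<Prod>i<n. [:- (s0 ^^ Suc i) (\<kappa> x), 1:])"
    by (simp add: q_def map.prod map_poly_pCons s0.zero s0.one s0.uminus)
  also have "\<dots> = q"
  proof -
    have shift: "(\<Prod>i<n. f (Suc i)) = (\<Prod>i<n. f i)" if "f n = f 0" for f :: "nat \<Rightarrow> 'k poly"
    proof (cases n)
      case (Suc k)
      have "(\<Prod>i<Suc k. f (Suc i)) = (\<Prod>i<k. f (Suc i)) * f 0"
        using that by (simp add: Suc)
      also have "\<dots> = (\<Prod>i<Suc k. f i)"
        by (simp only: prod.lessThan_Suc_shift mult.commute)
      finally show ?thesis
        by (simp only: Suc)
    qed simp
    show ?thesis
      unfolding q_def by (rule shift) (simp add: per)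
  qed
  finally have s0_q: "map_poly s0 q = q" .
  have "q \<noteq> 0"
    by (simp add: q_def)
  define p where "p = map \<iota> (rev (coeffs q))"
  have "\<iota> (coeff q i) \<in> F" for i
    using s0_q by (simp add: F_iff \<iota>_closed \<kappa>_\<iota>) (metis coeff_map_poly s0.zero)
  then have set_p: "set p \<subseteq> F"
    by (auto simp: p_def coeffs_def split: if_splits)
  have "hd p = \<iota> (lead_coeff q)"
    using \<open>q \<noteq> 0\<close> by (simp add: p_def hd_map hd_rev last_coeffs_eq_coeff_degree)
  then have "hd p \<noteq> \<zero>\<^bsub>K\<^esub>"
    using \<open>q \<noteq> 0\<close> by (metis \<kappa>_0 \<kappa>_\<iota> leading_coeff_0_iff)
  then have "p \<in> carrier (F[X]\<^bsub>K\<^esub>)"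
    using set_p by (simp add: univ_poly_def polynomial_def)
  moreover have "p \<noteq> []"
    using \<open>q \<noteq> 0\<close> by (simp add: p_def)
  moreover have "K.eval p x = \<zero>\<^bsub>K\<^esub>"
  proof -
    have "rev (map \<kappa> p) = coeffs q"
      by (simp add: p_def rev_map o_def \<kappa>_\<iota>)
    moreover have "poly q (\<kappa> x) = 0"
      using n(1) by (auto simp: q_def poly_prod intro!: bexI[of _ 0])
    ultimately have "\<kappa> (K.eval p x) = 0" "K.eval p x \<in> carrier K"
      using \<kappa>_eval[of p x] set_p F_closed x by auto
    then show ?thesis
      by (simp add: \<kappa>_eq_0)
  qed
  ultimately show ?thesis
    by (rule K.algebraicI)
qed

definition R :: "('a, 'm) ring_scheme" where "R = algebraic_closure_in K F"

lemma R_simps: "\<zero>\<^bsub>R\<^esub> = \<zero>\<^bsub>K\<^esub>" "\<one>\<^bsub>R\<^esub> = \<one>\<^bsub>K\<^esub>" "x \<oplus>\<^bsub>R\<^esub> y = x \<oplus>\<^bsub>K\<^esub> y" "x \<otimes>\<^bsub>R\<^esub> y = x \<otimes>\<^bsub>K\<^esub> y"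
  by (simp_all add: R_def algebraic_closure_in_def)

text \<open>Periodicity with a given \<open>n\<close> is a quantifier-free condition, so existential
  closedness can produce elements of the closure.\<close>

lemma carrier_R: "x \<in> carrier R \<longleftrightarrow> x \<in> carrier K \<and> (\<exists>n>0. (s ^^ n) x = x)"
  using algebraic_imp_periodic periodic_imp_algebraic
  by (auto simp: R_def algebraic_closure_in_def)

sublocale R: differential_field R D
proof -
  have "subfield (carrier R) K"
    using K.subfield_of_algebraics[OF subfield_F] by (simp add: R_def algebraic_closure_in_def)
  then have "field R"
    using K.subfield_iff(2) by (simp add: R_def algebraic_closure_in_def)
  then interpret field R .
  show "differential_field R D"
  proof
    have "add_pow R n \<one>\<^bsub>R\<^esub> = add_pow K n \<one>\<^bsub>K\<^esub>" for n :: nat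
      by (simp add: add_pow_def nat_pow_def R_simps)
    then show "add_pow R n \<one>\<^bsub>R\<^esub> \<noteq> \<zero>\<^bsub>R\<^esub>" if "n > 0" for n :: nat
      using K.char_zero[OF that] by (simp add: R_simps)
    \<comment> \<open>Since \<open>s\<close> commutes with \<open>D\<close>, every period of
      \<open>x\<close> is one of \<open>D x\<close>.\<close>
    show "D x \<in> carrier R" if "x \<in> carrier R" for x
    proof -
      from that obtain n where x: "x \<in> carrier K" "n > 0" "(s ^^ n) x = x"
        by (auto simp: carrier_R)
      have "(s ^^ i) (D x) = D ((s ^^ i) x)" for i
        using funpow_s[OF x(1)] by (induction i) (auto simp: K.commute)
      then show ?thesis
        using x by (auto simp: carrier_R K.deriv_closed)
    qed
  qed (auto simp: R_simps carrier_R K.deriv_add K.deriv_mult)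
qed

lemma \<kappa>_diff_eval:
  assumes P: "P \<in> R.diff_polys" and x: "x \<in> carrier R"
  shows "R.diff_eval P x \<in> carrier K"
    and "\<kappa> (R.diff_eval P x) = dpoly_eval (\<lambda>c. c) (\<lambda>i. (D0 ^^ i) (\<kappa> x)) (\<lambda>m. \<kappa> (P m))"
proof -
  interpret hom: ring_hom_cring R "ring_of_type_algebra :: 'k ring" \<kappa>
    by (intro ring_hom_cring.intro ring_hom_cring_axioms.intro R.cring_axioms T.cring_axioms
        ring_hom_memI) (auto simp: carrier_R R_simps)
  have P_R: "P m \<in> carrier R" for m
    using P R.indexed_pset_finite_support(2) by (simp add: R.diff_polys_def)
  have D_R: "(D ^^ i) x \<in> carrier R" for i
    by (induction i) (auto simp: x R.deriv_closed)
  have "R.diff_eval P x \<in> carrier R"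
    unfolding R.diff_eval_def using P_R D_R
    by (intro R.finsum_closed) (auto intro!: R.finprod_closed)
  then show "R.diff_eval P x \<in> carrier K"
    by (simp add: carrier_R)
  have pow_R: "\<kappa> (y [^]\<^bsub>R\<^esub> (n::nat)) = \<kappa> y ^ n" if "y \<in> carrier R" for y n
    using that \<kappa>_pow[of y n] by (simp add: nat_pow_def R_simps carrier_R)
  have supp: "{m. P m \<noteq> \<zero>\<^bsub>R\<^esub>} = {m. \<kappa> (P m) \<noteq> 0}"
    using P_R by (auto simp: R_simps \<kappa>_eq_0 carrier_R)
  have "\<kappa> (R.diff_eval P x) = (\<Sum>m\<in>{m. P m \<noteq> \<zero>\<^bsub>R\<^esub>}. \<kappa> (P m) *
      (\<Prod>i\<in>set_mset m. \<kappa> ((D ^^ i) x) ^ count m i))"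
    unfolding R.diff_eval_def using P_R D_R
    by (simp add: Pi_def ring_of_type_algebra_finsum ring_of_type_algebra_finprod
        o_def pow_R hom.hom_finprod)
  also have "\<dots> = dpoly_eval (\<lambda>c. c) (\<lambda>i. (D0 ^^ i) (\<kappa> x)) (\<lambda>m. \<kappa> (P m))"
    using x by (simp add: dpoly_eval_def supp image_prod_mset_multiplicity funpow_D carrier_R)
  finally show "\<kappa> (R.diff_eval P x) = dpoly_eval (\<lambda>c. c) (\<lambda>i. (D0 ^^ i) (\<kappa> x)) (\<lambda>m. \<kappa> (P m))" .
qed

lemma \<kappa>_eval_term:
  assumes "set_sd_term t \<subseteq> carrier K" "\<forall>i. w i \<in> carrier K"
  shows "eval_term K D s id w t \<in> carrier K \<and>
    \<kappa> (eval_term K D s id w t) = eval_term ring_of_type_algebra D0 s0 \<kappa> (\<lambda>i. \<kappa> (w i)) t"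
  using assms(1)
  by (induction t)
    (auto simp: assms(2) \<kappa>_simps \<kappa>_0 \<kappa>_1 \<kappa>_D \<kappa>_s s_closed K.deriv_closed ring_of_type_algebra_simps
      a_minus_def a_inv_ring_of_type_algebra)

lemma Blum_axiom:
  assumes f: "f \<in> R.diff_polys" and g: "g \<in> R.diff_polys" "g \<noteq> (\<lambda>_. \<zero>\<^bsub>R\<^esub>)"
    and order: "R.diff_order g < R.diff_order f"
  shows "\<exists>a\<in>carrier R. R.diff_eval f a = \<zero>\<^bsub>R\<^esub> \<and> R.diff_eval g a \<noteq> \<zero>\<^bsub>R\<^esub>"
proof -
  define P where "P m = \<kappa> (f m)" for m
  define G where "G m = \<kappa> (g m)" for m
  have f_R: "f m \<in> carrier R" and g_R: "g m \<in> carrier R" for m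
    using f g(1) R.indexed_pset_finite_support(2) by (simp_all add: R.diff_polys_def)
  have fin: "finite {m. f m \<noteq> \<zero>\<^bsub>R\<^esub>}" "finite {m. g m \<noteq> \<zero>\<^bsub>R\<^esub>}"
    using f g(1) R.indexed_pset_finite_support(1) by (simp_all add: R.diff_polys_def)
  have P_0: "P m \<noteq> 0 \<longleftrightarrow> f m \<noteq> \<zero>\<^bsub>R\<^esub>" and G_0: "G m \<noteq> 0 \<longleftrightarrow> g m \<noteq> \<zero>\<^bsub>R\<^esub>" for m
    using f_R g_R by (simp_all add: P_def G_def R_simps \<kappa>_eq_0 carrier_R)
  have vars: "finite {i. \<not> R.index_free q i}" if "finite {m. q m \<noteq> \<zero>\<^bsub>R\<^esub>}" for q :: "nat multiset \<Rightarrow> 'a"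
    by (rule finite_subset[of _ "\<Union>m\<in>{m. q m \<noteq> \<zero>\<^bsub>R\<^esub>}. set_mset m"])
      (use that in \<open>auto simp: R.index_free_def\<close>)
  define N where "N = Max {i. \<not> R.index_free f i}"
  \<comment> \<open>The strict inequality of orders thus rules out the value \<open>-1\<close> for
    \<open>f\<close>, and the maximum \<open>N\<close> is taken over a nonempty set.\<close>
  have "R.diff_order g \<ge> - 1"
    by (simp add: R.diff_order_def)
  then have f_vars: "{i. \<not> R.index_free f i} \<noteq> {}" and f_order: "R.diff_order f = int N"
    using order by (auto simp: R.diff_order_def N_def split: if_splits)
  have "\<not> R.index_free f N"
    using Max_in[OF vars[OF fin(1)] f_vars] by (simp add: N_def)
  then obtain m0 where m0: "N \<in># m0" "f m0 \<noteq> \<zero>\<^bsub>R\<^esub>"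
    by (auto simp: R.index_free_def)
  have f_le: "i \<le> N" if "P m \<noteq> 0" "i \<in># m" for m i
    unfolding N_def using that vars[OF fin(1)] by (intro Max_ge) (auto simp: P_0 R.index_free_def)
  have g_less: "i < N" if "G m \<noteq> 0" "i \<in># m" for m i
  proof -
    have i: "i \<in> {i. \<not> R.index_free g i}"
      using that by (auto simp: G_0 R.index_free_def)
    then have "i \<le> Max {i. \<not> R.index_free g i}"
      using vars[OF fin(2)] by (intro Max_ge)
    moreover have "R.diff_order g = int (Max {i. \<not> R.index_free g i})"
      using i by (auto simp: R.diff_order_def)
    ultimately show ?thesis
      using order f_order by simp
  qed
  obtain k where k: "k > 0" "\<And>x. x \<in> f ` {m. f m \<noteq> \<zero>\<^bsub>R\<^esub>} \<union> g ` {m. g m \<noteq> \<zero>\<^bsub>R\<^esub>} \<Longrightarrow> (s ^^ k) x = x"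
    by (rule common_period[of "f ` {m. f m \<noteq> \<zero>\<^bsub>R\<^esub>} \<union> g ` {m. g m \<noteq> \<zero>\<^bsub>R\<^esub>}" s])
      (use fin f_R g_R in \<open>auto simp: carrier_R\<close>)
  have P_k: "(s0 ^^ k) (P m) = P m" for m
  proof (cases "P m = 0")
    case True
    then show ?thesis
      using ring_homo.zero[OF ring_homo_funpow[OF dd.s_homo]] by simp
  next
    case False
    then have "(s ^^ k) (f m) = f m"
      by (intro k(2)) (auto simp: P_0)
    then show ?thesis
      using funpow_s[of "f m" k] f_R by (simp add: P_def carrier_R)
  qed
  obtain t where t: "ring_homo t" "bij t" "\<And>x. t (to_ac x) = to_ac (s0 x)"
    using alg_closure_automorphism[OF dd.s_homo dd.s_bij] by blast
  have t0: "t 0 = 0"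
    using t(1) by (rule ring_homo.zero)
  have G_nz: "G \<noteq> (\<lambda>_. 0)"
    using g(2) by (auto simp: G_0 fun_eq_iff)
  obtain a n where a: "n > 0" "(fps_map t ^^ n) a = a"
    "dpoly_eval dd.taylor (\<lambda>i. (fps_deriv ^^ i) a) P = 0"
    "dpoly_eval dd.taylor (\<lambda>i. (fps_deriv ^^ i) a) G \<noteq> 0"
  proof (rule dd.periodic_solution[OF t(1,3) _ P_k _ m0(1) f_le _ G_nz g_less k(1)])
    show "finite {m. P m \<noteq> 0}" "finite {m. G m \<noteq> 0}" "P m0 \<noteq> 0"
      using fin m0(2) by (simp_all add: P_0 G_0)
  qed
  obtain fs gs where fs: "distinct fs" "set fs = {m. P m \<noteq> 0}"
    and gs: "distinct gs" "set gs = {m. G m \<noteq> 0}"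
    using finite_distinct_list[OF fin(1)] finite_distinct_list[OF fin(2)] by (auto simp: P_0 G_0)
  \<comment> \<open>The last conjunct records the period, so that the solution found in
    \<open>K\<close> lies in the closure of the fixed field.\<close>
  define \<phi> where "\<phi> = Conj (Equal (dpoly_term f fs) Zero)
    (Conj (Neg (Equal (dpoly_term g gs) Zero)) (Equal ((Sigma ^^ n) (Var 0)) (Var 0)))"
  have terms: "set_sd_term (dpoly_term f fs) \<subseteq> carrier K" "set_sd_term (dpoly_term g gs) \<subseteq> carrier K"
    using set_dpoly_term[of f fs] set_dpoly_term[of g gs] f_R g_R by (auto simp: carrier_R)
  define h where "h x = fps_to_fls (dd.taylor (\<kappa> x))" for x
  have deriv: "(fls_deriv ^^ i) (fps_to_fls b) = fps_to_fls ((fps_deriv ^^ i) b)"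
    for i and b :: "'k alg_closure fps"
    by (induction i) (auto simp: fls_deriv_fps_to_fls)
  have fls: "(\<Sum>m\<in>{m. Q m \<noteq> 0}. h (\<iota> (Q m)) * (\<Prod>i\<in>#m. (fls_deriv ^^ i) (fps_to_fls a))) =
      fps_to_fls (dpoly_eval dd.taylor (\<lambda>i. (fps_deriv ^^ i) a) Q)" for Q
  proof -
    have "ring_homo (fps_to_fls :: 'k alg_closure fps \<Rightarrow> _)"
      by (simp add: ring_homo_def fls_times_fps_to_fls)
    then show ?thesis
      by (simp add: h_def \<kappa>_\<iota> deriv dpoly_eval_def ring_homo.sum ring_homo.mult ring_homo.prod_mset)
  qed
  have f_\<iota>: "f m = \<iota> (P m)" and g_\<iota>: "g m = \<iota> (G m)" for m
    using f_R g_R by (simp_all add: P_def G_def \<iota>_\<kappa> carrier_R)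
  \<comment> \<open>The extension is the field of Laurent series over the algebraic closure. A
    constant valuation suffices, as \<open>\<phi>\<close> contains only the variable
    \<open>0\<close>.\<close>
  obtain w where w_K: "\<forall>i. w i \<in> carrier K" and w: "holds K D s id w \<phi>"
  proof (rule DCFA_existentially_closed[OF model])
    show "dd_field fls_deriv (fls_map t)"
      using ring_homo_fls_map[OF t(1)] bij_fls_map[OF t(1,2)] fls_map_deriv[OF t(1)]
      by (intro dd_field.intro) (auto simp: add.commute)
    show "h \<in> ring_hom K ring_of_type_algebra"
      using dd.taylor_homo
      by (intro ring_hom_memI)
        (auto simp: h_def ring_of_type_algebra_simps \<kappa>_simps \<kappa>_1 ring_homo.add ring_homo.mult
          ring_homo.one fls_times_fps_to_fls)
    show "h (D x) = fls_deriv (h x)" "h (s x) = fls_map t (h x)" if "x \<in> carrier K" for x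
      using that by (simp_all add: h_def \<kappa>_D \<kappa>_s dd.taylor_D fls_deriv_fps_to_fls
          fls_map_fps_to_fls[where t = t, OF t0] dd.fps_map_taylor[OF t(1,3)])
    show "set_sd_formula \<phi> \<subseteq> carrier K"
      using terms by (simp add: \<phi>_def set_Sigma_funpow)
    show "holds ring_of_type_algebra fls_deriv (fls_map t) h (\<lambda>_. fps_to_fls a) \<phi>"
      using a(2-4) by (simp add: \<phi>_def eval_dpoly_term[OF fs(1)] eval_dpoly_term[OF gs(1)] fs(2) gs(2)
          f_\<iota> g_\<iota> fls ring_of_type_algebra_simps eval_Sigma_funpow fls_map_funpow_fps_to_fls[where t = t, OF t0])
  qed
  have per: "(s ^^ n) (w 0) = w 0"
    using w by (simp add: \<phi>_def eval_Sigma_funpow)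
  then have w_R: "w 0 \<in> carrier R"
    using a(1) w_K by (auto simp: carrier_R)
  have "\<kappa> (eval_term K D s id w (dpoly_term f fs)) = \<kappa> (R.diff_eval f (w 0))"
    "\<kappa> (eval_term K D s id w (dpoly_term g gs)) = \<kappa> (R.diff_eval g (w 0))"
    using \<kappa>_eval_term[OF terms(1) w_K] \<kappa>_eval_term[OF terms(2) w_K]
    by (simp_all add: \<kappa>_diff_eval(2)[OF _ w_R] f g(1) eval_dpoly_term[OF fs(1)] eval_dpoly_term[OF gs(1)]
        fs(2) gs(2) dpoly_eval_def flip: P_def G_def)
  then have "\<kappa> (R.diff_eval f (w 0)) = 0" "\<kappa> (R.diff_eval g (w 0)) \<noteq> 0"
    using w \<kappa>_eval_term[OF terms(2) w_K] by (auto simp: \<phi>_def \<kappa>_0 \<kappa>_eq_0)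
  then show ?thesis
    using w_R \<kappa>_diff_eval(1)[OF f w_R] \<kappa>_diff_eval(1)[OF g(1) w_R]
    by (intro bexI[of _ "w 0"]) (simp_all add: \<kappa>_eq_0 R_simps)
qed

theorem DCF_model_algebraic_closure_Fix: "DCF_model (algebraic_closure_in K (Fix K s)) D"
  unfolding DCF_model_def using R.differential_field_axioms Blum_axiom
  by (auto simp: R_def F_def)

end

section \<open>Reduction to types\<close>

lemma ring_hom_add_pow:
  assumes "ring K" "ring S" "h \<in> ring_hom K S"
  shows "h (add_pow K n \<one>\<^bsub>K\<^esub>) = add_pow S (n::nat) \<one>\<^bsub>S\<^esub>"
proof -
  interpret K: ring K by fact
  interpret S: ring S by fact
  interpret ring_hom_ring K S h
    by (rule ring_hom_ringI2) (use assms in auto)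
  show ?thesis
    by (induction n) (simp_all add: K.add.nat_pow_Suc S.add.nat_pow_Suc)
qed

definition counterexample :: "('a, 'm) ring_scheme \<Rightarrow> ('a \<Rightarrow> 'a) \<Rightarrow> ('a \<Rightarrow> 'a) \<Rightarrow> bool" where
  "counterexample K D s \<longleftrightarrow>
    DCFA_model K D s \<and> \<not> DCF_model (algebraic_closure_in K (Fix K s)) D"

text \<open>The ring \<open>K\<close> has to become a type, because its algebraic closure and the Laurent series over
  the latter are only available as type constructors.  A type cannot depend on a variable, but it
  may depend on a fixed choice of a counterexample; the rational numbers take its place if there
  is none.\<close>

definition counterexample_ring :: "('a, 'm) ring_scheme itself \<Rightarrow> ('a + rat) ring" where
  "counterexample_ring _ =
    (if \<exists>(K :: ('a, 'm) ring_scheme) D s. counterexample K D s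
     then image_ring Inl (SOME K :: ('a, 'm) ring_scheme. \<exists>D s. counterexample K D s)
     else image_ring Inr ring_of_type_algebra)"

lemma field_counterexample_ring:
  fixes T :: "('a, 'm) ring_scheme itself"
  shows "field (counterexample_ring T)"
    and "n > 0 \<Longrightarrow> add_pow (counterexample_ring T) (n::nat) \<one>\<^bsub>counterexample_ring T\<^esub> \<noteq>
      \<zero>\<^bsub>counterexample_ring T\<^esub>"
proof -
  \<comment> \<open>Transport along an injection, to be applied to both summands of
    \<open>'a + rat\<close>.\<close>
  have image: "field (image_ring f R) \<and> (\<forall>n>0. add_pow (image_ring f R) (n::nat) \<one>\<^bsub>image_ring f R\<^esub> \<noteq> \<zero>\<^bsub>image_ring f R\<^esub>)"
    if "field R" "inj f" "\<And>n::nat. n > 0 \<Longrightarrow> add_pow R n \<one>\<^bsub>R\<^esub> \<noteq> \<zero>\<^bsub>R\<^esub>"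
    for f :: "'x \<Rightarrow> 'a + rat" and R :: "('x, 'n) ring_scheme"
  proof -
    interpret R: field R by fact
    have inj: "inj_on f (carrier R)"
      using that(2) by (rule inj_on_subset) simp
    have "field (image_ring f R)"
      using inj by (rule R.inj_imp_image_ring_is_field)
    then interpret I: field "image_ring f R" .
    have "f \<in> ring_hom R (image_ring f R)"
      using inj_imp_image_ring_iso[OF inj] by (simp add: ring_iso_def)
    then have "add_pow (image_ring f R) n \<one>\<^bsub>image_ring f R\<^esub> = f (add_pow R n \<one>\<^bsub>R\<^esub>)" for n :: nat
      by (rule ring_hom_add_pow[OF R.ring_axioms I.ring_axioms, symmetric])
    then show ?thesis
      using that(2,3) I.field_axioms by (auto simp: image_ring_zero inj_eq)
  qed
  have "field (counterexample_ring T) \<and>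
    (\<forall>n>0. add_pow (counterexample_ring T) (n::nat) \<one>\<^bsub>counterexample_ring T\<^esub> \<noteq> \<zero>\<^bsub>counterexample_ring T\<^esub>)"
  proof (cases "\<exists>(K :: ('a, 'm) ring_scheme) D s. counterexample K D s")
    case True
    define K where "K = (SOME K :: ('a, 'm) ring_scheme. \<exists>D s. counterexample K D s)"
    obtain D s where "counterexample K D s"
      using someI_ex[OF True] by (auto simp: K_def)
    then interpret difference_differential_field K D s
      by (simp add: counterexample_def DCFA_model_def)
    show ?thesis
      using image[OF field_axioms _ char_zero, of Inl] True
      by (simp add: counterexample_ring_def K_def)
  next
    case False
    have "field (ring_of_type_algebra :: rat ring)" by auto
    moreover have "add_pow (ring_of_type_algebra :: rat ring) n \<one>\<^bsub>ring_of_type_algebra\<^esub> = of_nat n" for n :: nat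
      using ring_hom_of_nat[OF ring_from_type_algebra id_ring_hom, of n] by simp
    ultimately show ?thesis
      using image[of "ring_of_type_algebra :: rat ring" Inr] False
      by (simp add: counterexample_ring_def ring_of_type_algebra_simps)
  qed
  then show "field (counterexample_ring T)"
    and "n > 0 \<Longrightarrow> add_pow (counterexample_ring T) (n::nat) \<one>\<^bsub>counterexample_ring T\<^esub> \<noteq>
      \<zero>\<^bsub>counterexample_ring T\<^esub>"
    by blast+
qed

text \<open>The parameter \<open>'m\<close> is present because the chosen counterexample depends on
  the record extension.\<close>

typedef ('a, 'm) counterexample_field =
  "carrier (counterexample_ring TYPE(('a, 'm) ring_scheme))"
proof -
  interpret field "counterexample_ring TYPE(('a, 'm) ring_scheme)"
    by (rule field_counterexample_ring)
  show "\<exists>x. x \<in> carrier (counterexample_ring TYPE(('a, 'm) ring_scheme))"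
    using zero_closed by blast
qed

setup_lifting type_definition_counterexample_field

instantiation counterexample_field :: (type, type) field
begin

context
  fixes L
  defines "L \<equiv> counterexample_ring TYPE(('a, 'm) ring_scheme)"
begin

interpretation L: field L
  unfolding L_def by (rule field_counterexample_ring)

lift_definition zero_counterexample_field :: "('a, 'm) counterexample_field" is "\<zero>\<^bsub>L\<^esub>"
  by (fold L_def) simp

lift_definition one_counterexample_field :: "('a, 'm) counterexample_field" is "\<one>\<^bsub>L\<^esub>"
  by (fold L_def) simp

lift_definition plus_counterexample_field :: "('a, 'm) counterexample_field \<Rightarrow>
    ('a, 'm) counterexample_field \<Rightarrow> ('a, 'm) counterexample_field" is "ring.add L"
  by (fold L_def) simp

lift_definition minus_counterexample_field :: "('a, 'm) counterexample_field \<Rightarrow>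
    ('a, 'm) counterexample_field \<Rightarrow> ('a, 'm) counterexample_field" is "a_minus L"
  by (fold L_def) simp

lift_definition times_counterexample_field :: "('a, 'm) counterexample_field \<Rightarrow>
    ('a, 'm) counterexample_field \<Rightarrow> ('a, 'm) counterexample_field" is "monoid.mult L"
  by (fold L_def) simp

lift_definition uminus_counterexample_field :: "('a, 'm) counterexample_field \<Rightarrow>
    ('a, 'm) counterexample_field" is "a_inv L"
  by (fold L_def) simp

lift_definition inverse_counterexample_field :: "('a, 'm) counterexample_field \<Rightarrow>
    ('a, 'm) counterexample_field" is "\<lambda>x. if x = \<zero>\<^bsub>L\<^esub> then \<zero>\<^bsub>L\<^esub> else m_inv L x"
  by (fold L_def) (auto simp: L.field_Units)

lift_definition divide_counterexample_field :: "('a, 'm) counterexample_field \<Rightarrow>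
    ('a, 'm) counterexample_field \<Rightarrow> ('a, 'm) counterexample_field"
  is "\<lambda>x y. if y = \<zero>\<^bsub>L\<^esub> then \<zero>\<^bsub>L\<^esub> else monoid.mult L x (m_inv L y)"
  by (fold L_def) (auto simp: L.field_Units)

end

instance
proof -
  define L where "L = counterexample_ring TYPE(('a, 'm) ring_scheme)"
  interpret L: field L
    unfolding L_def by (rule field_counterexample_ring)
  show "OFCLASS(('a, 'm) counterexample_field, field_class)"
  proof (standard, goal_cases)
    case 1 show ?case by (transfer, fold L_def) (rule L.m_assoc)
  next
    case 2 show ?case by (transfer, fold L_def) (rule L.m_comm)
  next
    case 3 show ?case by (transfer, fold L_def) (rule L.l_one)
  next
    case 4 show ?case by (transfer, fold L_def) (rule L.a_assoc)
  next
    case 5 show ?case by (transfer, fold L_def) (rule L.a_comm)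
  next
    case 6 show ?case by (transfer, fold L_def) (rule L.l_zero)
  next
    case 7 show ?case by (transfer, fold L_def) (rule L.l_neg)
  next
    case 8 show ?case by (transfer, fold L_def) (rule a_minus_def)
  next
    case 9 show ?case by (transfer, fold L_def) (rule L.l_distr)
  next
    case 10 show ?case by (transfer, fold L_def) (rule L.zero_not_one)
  next
    case 11 then show ?case by (transfer, fold L_def) (auto simp: L.field_Units)
  next
    case 12 then show ?case by (transfer, fold L_def) auto
  next
    case 13 then show ?case by transfer auto
  qed
qed

end

lemma Rep_counterexample_field_of_nat:
  "Rep_counterexample_field (of_nat n :: ('a, 'm) counterexample_field) =
    add_pow (counterexample_ring TYPE(('a, 'm) ring_scheme)) n
      \<one>\<^bsub>counterexample_ring TYPE(('a, 'm) ring_scheme)\<^esub>"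
proof -
  define L where "L = counterexample_ring TYPE(('a, 'm) ring_scheme)"
  interpret L: field L
    unfolding L_def by (rule field_counterexample_ring)
  show ?thesis
    unfolding L_def[symmetric]
    by (induction n) (simp_all add: zero_counterexample_field.rep_eq one_counterexample_field.rep_eq
        plus_counterexample_field.rep_eq L.a_comm flip: L_def)
qed

instance counterexample_field :: (type, type) semiring_char_0
proof
  have nonzero: "(of_nat n :: ('a, 'm) counterexample_field) \<noteq> 0" if "n > 0" for n
    using field_counterexample_ring(2)[OF that, of "TYPE(('a, 'm) ring_scheme)"]
    by (metis Rep_counterexample_field_of_nat zero_counterexample_field.rep_eq)
  show "inj (of_nat :: nat \<Rightarrow> ('a, 'm) counterexample_field)"
  proof (rule linorder_injI)
    fix x y :: nat
    assume "x < y"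
    then obtain k where "k > 0" "y = x + k"
      using less_imp_add_positive by blast
    then show "(of_nat x :: ('a, 'm) counterexample_field) \<noteq> of_nat y"
      using nonzero[of k] by simp
  qed
qed

instance counterexample_field :: (type, type) ring_char_0 ..

instance counterexample_field :: (type, type) field_char_0 ..

theorem theorem2p3p4:
  fixes K :: "('a, 'm) ring_scheme" and \<sigma> D :: "'a \<Rightarrow> 'a"
  assumes "DCFA_model K D \<sigma>"
  shows "DCF_model (algebraic_closure_in K (Fix K \<sigma>)) D"
proof (rule ccontr)
  assume "\<not> ?thesis"
  then have ex: "\<exists>(K :: ('a, 'm) ring_scheme) D s. counterexample K D s"
    using assms by (auto simp: counterexample_def)
  \<comment> \<open>The chosen counterexample \<open>K0\<close> may differ from \<open>K\<close>. It
    suffices to refute \<open>K0\<close>, whose existence follows from the failure for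
    \<open>K\<close>.\<close>
  define K0 where "K0 = (SOME K :: ('a, 'm) ring_scheme. \<exists>D s. counterexample K D s)"
  obtain D0 s0 where cx: "counterexample K0 D0 s0"
    using someI_ex[OF ex] by (auto simp: K0_def)
  have L: "counterexample_ring TYPE(('a, 'm) ring_scheme) = image_ring Inl K0"
    using ex by (simp add: counterexample_ring_def K0_def)
  define \<kappa> :: "'a \<Rightarrow> ('a, 'm) counterexample_field" where
    "\<kappa> x = Abs_counterexample_field (Inl x)" for x
  have Rep: "Rep_counterexample_field (\<kappa> x) = Inl x" if "x \<in> carrier K0" for x
    using that by (simp add: \<kappa>_def Abs_counterexample_field_inverse L image_ring_carrier)
  have Inl: "(Inl :: 'a \<Rightarrow> 'a + rat) \<in> ring_iso K0 (image_ring Inl K0)"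
    by (rule inj_imp_image_ring_iso) simp
  interpret K0: difference_differential_field K0 D0 s0
    using cx by (simp add: counterexample_def DCFA_model_def)
  have "\<kappa> \<in> ring_iso K0 ring_of_type_algebra"
  proof (rule ring_iso_memI)
    fix x y assume xy: "x \<in> carrier K0" "y \<in> carrier K0"
    show "\<kappa> (x \<otimes>\<^bsub>K0\<^esub> y) = \<kappa> x \<otimes>\<^bsub>ring_of_type_algebra\<^esub> \<kappa> y"
      "\<kappa> (x \<oplus>\<^bsub>K0\<^esub> y) = \<kappa> x \<oplus>\<^bsub>ring_of_type_algebra\<^esub> \<kappa> y"
      using xy Inl
      by (simp_all add: ring_of_type_algebra_simps Rep L ring_iso_def ring_hom_def
          times_counterexample_field.rep_eq plus_counterexample_field.rep_eq
          flip: Rep_counterexample_field_inject)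
  next
    show "\<kappa> \<one>\<^bsub>K0\<^esub> = \<one>\<^bsub>ring_of_type_algebra\<^esub>"
      by (simp add: ring_of_type_algebra_simps Rep L image_ring_one one_counterexample_field.rep_eq
          flip: Rep_counterexample_field_inject)
  next
    have "inj_on \<kappa> (carrier K0)"
      by (intro inj_onI) (metis Inl_inject Rep)
    moreover have "y \<in> \<kappa> ` carrier K0" for y
    proof -
      obtain x where "x \<in> carrier K0" "Rep_counterexample_field y = Inl x"
        using Rep_counterexample_field[of y] by (auto simp: L image_ring_carrier)
      then have "y = \<kappa> x"
        by (simp add: Rep flip: Rep_counterexample_field_inject)
      then show ?thesis
        using \<open>x \<in> carrier K0\<close> by blast
    qed
    ultimately show "bij_betw \<kappa> (carrier K0) (carrier ring_of_type_algebra)"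
      by (auto simp: bij_betw_def ring_of_type_algebra_simps)
  qed (simp add: ring_of_type_algebra_simps)
  then have "typed_DCFA K0 D0 s0 \<kappa>"
    using cx by (intro typed_DCFA.intro) (simp_all add: counterexample_def)
  then show False
    using cx typed_DCFA.DCF_model_algebraic_closure_Fix by (auto simp: counterexample_def)
qed

end
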